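(* Let $\mathbbm{I}=(\mathcal{F},\mathbb{M})$ be any CICS instance. Then $\mathrm{ComGap}(\mathbbm{I})\le\alpha(\mathcal{F})$, where $\alpha(\mathcal{F})=e/(e-1)$ if $\mathcal{F}$ is the family of independent sets of a matroid on $[n]$; $\alpha(\mathcal{F})=k+1$ if $\mathcal{F}$ is a $k$-system; and $\alpha(\mathcal{F})=3.135$ if $\mathcal{F}$ is a knapsack constraint.
   Context: CICS: an instance $\mathbbm{I}=(\mathcal{F},\mathbb{M})$ consists of a downwards-closed $\mathcal{F}\subseteq 2^{[n]}$ and $n$ acyclic Markov decision processes $\mathcal{M}_i$, each with a finite state set, root $\sigma_i$, actions $A_i(s)$ with nonnegative costs $c_i(a)$ and transition distributions $\Pi_i(s,a)$, and sink (terminal) states $T_i$ with values $v_i(t)\ge0$. A policy starts with all MDPs at their roots and repeatedly (adaptively) either advances some MDP in a non-terminal state by an action (paying its cost, random transition), or halts by selecting $S\in\mathcal{F}$ among MDPs currently in terminal states, collecting $\sum_{i\in S}v_i(s_i)$; its utility is expected collected value minus expected cost, and $\mathrm{OPT}(\mathbbm{I})$ is the optimal utility. A commitment $(\pi_1,\dots,\pi_n)$ assigns each state $s$ of $\mathcal{M}_i$ a distribution $\pi_i(s)$ over $A_i(s)$; a committing policy draws its action from $\pi_i(s)$ whenever it advances $\mathcal{M}_i$ at state $s$. $\mathrm{ComGap}(\mathbbm{I})=\mathrm{OPT}(\mathbbm{I})/\sup\{\mathrm{Util}(\mathcal{T}):\mathcal{T}\text{ committing}\}$. A $k$-system is a family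 $\mathcal{F}\subseteq 2^{[n]}$ such that for every $S\subseteq[n]$, $\max_{A\in B(S)}|A|\le k\min_{A\in B(S)}|A|$, where $B(S)$ is the set of maximal members of $\mathcal{F}$ contained in $S$. A knapsack constraint is $\mathcal{F}=\{S\subseteq[n]:\sum_{i\in S}s_i\le1\}$ for sizes $s\in[0,1]^n$. *)

theory Defs
  imports "HOL-Probability.Probability"
begin

record ('s, 'a) mdp =
  mstates :: "'s set"
  mroot   :: 's
  macts   :: "'s \<Rightarrow> 'a set"
  mcost   :: "'a \<Rightarrow> real"
  mtrans  :: "'s \<Rightarrow> 'a \<Rightarrow> 's pmf"
  mterm   :: "'s set"
  mval    :: "'s \<Rightarrow> real"

definition mdp_edges :: "('s, 'a) mdp \<Rightarrow> ('s \<times> 's) set" where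
  "mdp_edges M = {(s, s'). s \<in> mstates M \<and> (\<exists>a \<in> macts M s. s' \<in> set_pmf (mtrans M s a))}"

definition wf_mdp :: "('s, 'a) mdp \<Rightarrow> bool" where
  "wf_mdp M \<longleftrightarrow>
     finite (mstates M) \<and> mroot M \<in> mstates M \<and> mterm M \<subseteq> mstates M \<and>
     (\<forall>t \<in> mterm M. macts M t = {} \<and> mval M t \<ge> 0) \<and>
     (\<forall>s \<in> mstates M - mterm M. macts M s \<noteq> {} \<and>
        (\<forall>a \<in> macts M s. mcost M a \<ge> 0 \<and> set_pmf (mtrans M s a) \<subseteq> mstates M)) \<and>
     acyclic (mdp_edges M)"

definition downward_closed :: "nat set set \<Rightarrow> bool" where
  "downward_closed F \<longleftrightarrow> (\<forall>A \<in> F. \<forall>B. B \<subseteq> A \<longrightarrow> B \<in> F)"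

definition cics_instance :: "nat \<Rightarrow> nat set set \<Rightarrow> (nat \<Rightarrow> ('s, 'a) mdp) \<Rightarrow> bool" where
  "cics_instance n F M \<longleftrightarrow>
     F \<subseteq> Pow {..<n} \<and> F \<noteq> {} \<and> downward_closed F \<and> (\<forall>i < n. wf_mdp (M i))"

datatype 'a decision = Adv nat 'a | Halt "nat set"

type_synonym ('s, 'a) history = "('a decision \<times> (nat \<Rightarrow> 's)) list"

text \<open>A (randomised, adaptive, history-dependent) policy: given the history of decisions and
  resulting configurations and the current configuration, a distribution over decisions.\<close>
type_synonym ('s, 'a) policy = "('s, 'a) history \<Rightarrow> (nat \<Rightarrow> 's) \<Rightarrow> 'a decision pmf"

definition legal_halt :: "nat set set \<Rightarrow> (nat \<Rightarrow> ('s, 'a) mdp) \<Rightarrow> (nat \<Rightarrow> 's) \<Rightarrow> nat set \<Rightarrow> bool" where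
  "legal_halt F M x S \<longleftrightarrow> S \<in> F \<and> (\<forall>i \<in> S. x i \<in> mterm (M i))"

definition legal_adv :: "nat \<Rightarrow> (nat \<Rightarrow> ('s, 'a) mdp) \<Rightarrow> (nat \<Rightarrow> 's) \<Rightarrow> nat \<Rightarrow> 'a \<Rightarrow> bool" where
  "legal_adv n M x i a \<longleftrightarrow> i < n \<and> x i \<notin> mterm (M i) \<and> a \<in> macts (M i) (x i)"

text \<open>Expected utility with a step budget (fuel). An illegal decision ends the process with no
  further value or cost (i.e. it is treated as halting with the empty set, which is always legal).\<close>
primrec util_fuel :: "nat \<Rightarrow> nat \<Rightarrow> nat set set \<Rightarrow> (nat \<Rightarrow> ('s, 'a) mdp) \<Rightarrow> ('s, 'a) policy
                        \<Rightarrow> ('s, 'a) history \<Rightarrow> (nat \<Rightarrow> 's) \<Rightarrow> real" where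
  "util_fuel 0 n F M P h x = 0"
| "util_fuel (Suc k) n F M P h x =
     measure_pmf.expectation (P h x) (\<lambda>d. case d of
        Halt S \<Rightarrow> (if legal_halt F M x S then (\<Sum>i\<in>S. mval (M i) (x i)) else 0)
      | Adv i a \<Rightarrow> (if legal_adv n M x i a then
            - mcost (M i) a + measure_pmf.expectation (mtrans (M i) (x i) a)
                 (\<lambda>s'. util_fuel k n F M P (h @ [(d, x(i := s'))]) (x(i := s')))
          else 0))"

text \<open>Since every MDP is acyclic with finitely many states, any run makes at most
  sum of card(states) legal moves; this budget is therefore never exhausted.\<close>
definition horizon :: "nat \<Rightarrow> (nat \<Rightarrow> ('s, 'a) mdp) \<Rightarrow> nat" where
  "horizon n M = (\<Sum>i<n. card (mstates (M i))) + 1"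

definition Util :: "nat \<Rightarrow> nat set set \<Rightarrow> (nat \<Rightarrow> ('s, 'a) mdp) \<Rightarrow> ('s, 'a) policy \<Rightarrow> real" where
  "Util n F M P = util_fuel (horizon n M) n F M P [] (\<lambda>i. mroot (M i))"

definition OPT :: "nat \<Rightarrow> nat set set \<Rightarrow> (nat \<Rightarrow> ('s, 'a) mdp) \<Rightarrow> real" where
  "OPT n F M = (SUP P. Util n F M P)"

definition commitment :: "nat \<Rightarrow> (nat \<Rightarrow> ('s, 'a) mdp) \<Rightarrow> (nat \<Rightarrow> 's \<Rightarrow> 'a pmf) \<Rightarrow> bool" where
  "commitment n M \<pi> \<longleftrightarrow>
     (\<forall>i < n. \<forall>s \<in> mstates (M i) - mterm (M i). set_pmf (\<pi> i s) \<subseteq> macts (M i) s)"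

datatype cdecision = CAdv nat | CHalt "nat set"

definition committing :: "(nat \<Rightarrow> 's \<Rightarrow> 'a pmf) \<Rightarrow> ('s, 'a) policy \<Rightarrow> bool" where
  "committing \<pi> P \<longleftrightarrow>
     (\<exists>Q :: ('s, 'a) history \<Rightarrow> (nat \<Rightarrow> 's) \<Rightarrow> cdecision pmf.
        \<forall>h x. P h x = bind_pmf (Q h x) (\<lambda>c. case c of
                 CAdv i \<Rightarrow> map_pmf (Adv i) (\<pi> i (x i))
               | CHalt S \<Rightarrow> return_pmf (Halt S)))"

definition ComOPT :: "nat \<Rightarrow> nat set set \<Rightarrow> (nat \<Rightarrow> ('s, 'a) mdp) \<Rightarrow> real" where
  "ComOPT n F M =
     (SUP P \<in> {P. \<exists>\<pi>. commitment n M \<pi> \<and> committing \<pi> P}. Util n F M P)"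

definition ComGap :: "nat \<Rightarrow> nat set set \<Rightarrow> (nat \<Rightarrow> ('s, 'a) mdp) \<Rightarrow> real" where
  "ComGap n F M = OPT n F M / ComOPT n F M"

definition matroid_indep :: "nat \<Rightarrow> nat set set \<Rightarrow> bool" where
  "matroid_indep n F \<longleftrightarrow>
     F \<subseteq> Pow {..<n} \<and> {} \<in> F \<and> downward_closed F \<and>
     (\<forall>A \<in> F. \<forall>B \<in> F. card A < card B \<longrightarrow> (\<exists>x \<in> B - A. insert x A \<in> F))"

definition maximal_in :: "nat set set \<Rightarrow> nat set \<Rightarrow> nat set set" where
  "maximal_in F S = {A \<in> F. A \<subseteq> S \<and> (\<forall>B \<in> F. A \<subseteq> B \<and> B \<subseteq> S \<longrightarrow> B = A)}"

definition k_system :: "nat \<Rightarrow> nat \<Rightarrow> nat set set \<Rightarrow> bool" where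
  "k_system k n F \<longleftrightarrow> F \<subseteq> Pow {..<n} \<and>
     (\<forall>S \<subseteq> {..<n}. Max (card ` maximal_in F S) \<le> k * Min (card ` maximal_in F S))"

definition knapsack :: "nat \<Rightarrow> nat set set \<Rightarrow> bool" where
  "knapsack n F \<longleftrightarrow> (\<exists>sz :: nat \<Rightarrow> real. (\<forall>i < n. 0 \<le> sz i \<and> sz i \<le> 1) \<and>
     F = {S. S \<subseteq> {..<n} \<and> (\<Sum>i\<in>S. sz i) \<le> 1})"

end

theory Submission
  imports Defs
begin

text \<open>A policy is split into the utility \<open>u\<^sub>i\<close> and the selection probability \<open>q\<^sub>i\<close> that it
  obtains from each MDP. The vector \<open>q\<close> lies in the convex hull of \<open>F\<close>, and for every price \<open>\<lambda>\<close> the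
  quantity \<open>u\<^sub>i - \<lambda> q\<^sub>i\<close> is at most the optimum of the \<open>i\<close>-th MDP alone when selection costs \<open>\<lambda>\<close>;
  that optimum is approached by deterministic Markov strategies. Consider now the policies that go
  through the MDPs in a fixed order and run the \<open>i\<close>-th one to completion iff adding \<open>i\<close> to the current
  selection keeps it feasible. Their utility is affine in each pair \<open>(q\<^sub>i, u\<^sub>i)\<close>, so the abstract pairs
  can be replaced one at a time by pairs of Markov strategies, and the result is committing. It
  remains to bound this sequential greedy value against \<open>\<Sum> u\<^sub>i\<close>: for matroids (correlation gap) and
  \<open>k\<close>-systems the order is by decreasing \<open>u\<^sub>i / q\<^sub>i\<close>; for knapsacks it is by decreasing size, which even
  gives the factor 3.\<close>

section \<open>Sequential greedy selection\<close>

text \<open>Expectation of \<open>g\<close> at the final selection when each feasible item joins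
  according to an independent coin. For \<open>F = UNIV\<close> and distinct \<open>l\<close>
  nothing is rejected, and this is the multilinear extension of \<open>g\<close>.\<close>

fun greedy_ex :: "nat set set \<Rightarrow> (nat \<Rightarrow> real) \<Rightarrow> nat list \<Rightarrow> (nat set \<Rightarrow> real) \<Rightarrow> nat set \<Rightarrow> real" where
  "greedy_ex F q [] g S = g S"
| "greedy_ex F q (j # l) g S =
     (if insert j S \<in> F then q j * greedy_ex F q l g (insert j S) + (1 - q j) * greedy_ex F q l g S
      else greedy_ex F q l g S)"

text \<open>Here \<open>u j\<close> is already averaged over success and failure of the
  \<open>j\<close>-th MDP, so it is collected as soon as \<open>j\<close> is run, whatever its coin
  shows.\<close>

fun greedy_val :: "nat set set \<Rightarrow> (nat \<Rightarrow> real) \<Rightarrow> (nat \<Rightarrow> real) \<Rightarrow> nat list \<Rightarrow> nat set \<Rightarrow> real" where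
  "greedy_val F q u [] S = 0"
| "greedy_val F q u (j # l) S =
     (if insert j S \<in> F then u j + q j * greedy_val F q u l (insert j S) + (1 - q j) * greedy_val F q u l S
      else greedy_val F q u l S)"

lemma greedy_ex_cong: "(\<And>i. i \<in> set l \<Longrightarrow> q i = q' i) \<Longrightarrow> greedy_ex F q l g S = greedy_ex F q' l g S"
  by (induction l arbitrary: S) auto

lemma greedy_val_cong:
  "(\<And>i. i \<in> set l \<Longrightarrow> q i = q' i) \<Longrightarrow> (\<And>i. i \<in> set l \<Longrightarrow> u i = u' i) \<Longrightarrow>
     greedy_val F q u l S = greedy_val F q' u' l S"
  by (induction l arbitrary: S) auto

lemma greedy_ex_append: "greedy_ex F q (l @ l') g S = greedy_ex F q l (greedy_ex F q l' g) S"
  by (induction l arbitrary: S) auto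

lemma greedy_ex_const: "greedy_ex F q l (\<lambda>_. c) S = c"
  by (induction l arbitrary: S) (auto simp: algebra_simps)

lemma greedy_ex_add: "greedy_ex F q l (\<lambda>T. f T + g T) S = greedy_ex F q l f S + greedy_ex F q l g S"
  by (induction l arbitrary: S) (auto simp: algebra_simps)

lemma greedy_ex_cmult: "greedy_ex F q l (\<lambda>T. c * f T) S = c * greedy_ex F q l f S"
  by (induction l arbitrary: S) (auto simp: algebra_simps)

lemma greedy_ex_diff: "greedy_ex F q l (\<lambda>T. f T - g T) S = greedy_ex F q l f S - greedy_ex F q l g S"
  using greedy_ex_add[of F q l "\<lambda>T. f T - g T" g S] by simp

lemma greedy_ex_sum: "greedy_ex F q l (\<lambda>T. \<Sum>i\<in>I. f i T) S = (\<Sum>i\<in>I. greedy_ex F q l (f i) S)"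
proof (induction I rule: infinite_finite_induct)
  case (insert i I)
  then show ?case by (simp add: greedy_ex_add)
qed (auto simp: greedy_ex_const)

text \<open>Only reachable sets \<open>T\<close> have to be compared. Feasibility of
  \<open>T\<close> appears as an implication because a run from an infeasible \<open>S\<close> may
  end in \<open>S\<close> itself.\<close>

lemma greedy_ex_mono:
  assumes "\<And>i. i \<in> set l \<Longrightarrow> 0 \<le> q i \<and> q i \<le> 1"
    and "\<And>T. T \<subseteq> S \<union> set l \<Longrightarrow> S \<subseteq> T \<Longrightarrow> (S \<in> F \<Longrightarrow> T \<in> F) \<Longrightarrow> f T \<le> g T"
  shows "greedy_ex F q l f S \<le> greedy_ex F q l g S"
  using assms
proof (induction l arbitrary: S)
  case Nil
  then show ?case by auto
next
  case (Cons j l)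
  have 1: "greedy_ex F q l f S \<le> greedy_ex F q l g S"
  proof (rule Cons.IH)
    show "f T \<le> g T" if "T \<subseteq> S \<union> set l" "S \<subseteq> T" "S \<in> F \<Longrightarrow> T \<in> F" for T
      using that by (intro Cons.prems(2)) auto
  qed (use Cons.prems(1) in auto)
  have 2: "greedy_ex F q l f (insert j S) \<le> greedy_ex F q l g (insert j S)" if "insert j S \<in> F"
  proof (rule Cons.IH)
    show "f T \<le> g T" if "T \<subseteq> insert j S \<union> set l" "insert j S \<subseteq> T" "insert j S \<in> F \<Longrightarrow> T \<in> F" for T
      using that \<open>insert j S \<in> F\<close> by (intro Cons.prems(2)) auto
  qed (use Cons.prems(1) in auto)
  have "0 \<le> q j" "q j \<le> 1" using Cons.prems(1)[of j] by auto
  then show ?case using 1 2 by (auto intro!: add_mono mult_left_mono)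
qed

text \<open>The last item influences no earlier one, so it adds \<open>u j\<close> times the
  probability that it is unblocked. The inductions from the end of the list rest on this.\<close>

lemma greedy_val_snoc:
  "greedy_val F q u (l @ [j]) S =
     greedy_val F q u l S + u j * greedy_ex F q l (\<lambda>T. of_bool (insert j T \<in> F)) S"
  by (induction l arbitrary: S) (auto simp: algebra_simps)

text \<open>An item that gets its turn joins with probability \<open>q i\<close> and brings
  \<open>a i\<close>, which amounts to an expected utility of \<open>a i * q i\<close>.\<close>

lemma greedy_ex_sum_elements:
  assumes "distinct l" "finite S" "S \<inter> set l = {}"
  shows "greedy_ex F q l (\<lambda>T. \<Sum>i\<in>T. a i) S = (\<Sum>i\<in>S. a i) + greedy_val F q (\<lambda>i. a i * q i) l S"
  using assms by (induction l arbitrary: S) (auto simp: algebra_simps)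

text \<open>Item \<open>i\<close> occurs at most once. The slope \<open>p\<close> is the probability
  that it is run, and \<open>lam\<close> is its opportunity cost: the expected loss of later value
  caused by selecting it.\<close>

lemma greedy_val_affine:
  assumes "distinct l" "\<And>j. j \<in> set l \<Longrightarrow> 0 \<le> q j \<and> q j \<le> 1"
  shows "\<exists>A p lam. 0 \<le> p \<and> p \<le> 1 \<and>
    (\<forall>q' u'. greedy_val F (q(i := q')) (u(i := u')) l S = A + p * (u' - lam * q'))"
  using assms
proof (induction l arbitrary: S)
  case Nil
  show ?case by (rule exI[of _ 0], rule exI[of _ 0]) auto
next
  case (Cons j l)
  have IH: "\<exists>A p lam. 0 \<le> p \<and> p \<le> 1 \<and>
    (\<forall>q' u'. greedy_val F (q(i := q')) (u(i := u')) l S = A + p * (u' - lam * q'))" for S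
    by (rule Cons.IH) (use Cons.prems in auto)
  show ?case
  proof (cases "insert j S \<in> F")
    case False
    then have "greedy_val F q1 u1 (j # l) S = greedy_val F q1 u1 l S" for q1 u1 by simp
    then show ?thesis using IH[of S] by presburger
  next
    case feas: True
    show ?thesis
    proof (cases "j = i")
      case True
      then have "i \<notin> set l" using Cons.prems by auto
      then have eq: "greedy_val F (q(i := q')) (u(i := u')) l T = greedy_val F q u l T" for q' u' T
        by (intro greedy_val_cong) auto
      show ?thesis
        by (rule exI[of _ "greedy_val F q u l S"], rule exI[of _ 1],
            rule exI[of _ "greedy_val F q u l S - greedy_val F q u l (insert i S)"])
          (use feas True eq in \<open>simp add: algebra_simps del: fun_upd_apply add: fun_upd_same\<close>)
    next
      case False
      obtain A1 p1 lam1 where 1: "0 \<le> p1" "p1 \<le> 1" and e1: "\<And>q' u'.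
          greedy_val F (q(i := q')) (u(i := u')) l S = A1 + p1 * (u' - lam1 * q')"
        using IH[of S] by blast
      obtain A2 p2 lam2 where 2: "0 \<le> p2" "p2 \<le> 1" and e2: "\<And>q' u'.
          greedy_val F (q(i := q')) (u(i := u')) l (insert j S) = A2 + p2 * (u' - lam2 * q')"
        using IH[of "insert j S"] by blast
      have q: "0 \<le> q j" "q j \<le> 1" using Cons.prems by auto
      define p where "p = q j * p2 + (1 - q j) * p1"
      \<comment> \<open>The average of the two prices with weights \<open>q j * p2\<close> and
        \<open>(1 - q j) * p1\<close>. If \<open>p = 0\<close>, both weights vanish, and the value 0
        produced by the division is harmless.\<close>
      define lam where "lam = (q j * p2 * lam2 + (1 - q j) * p1 * lam1) / p"
      have p: "0 \<le> p" "p \<le> 1"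
        using q 1 2 convex_bound_le[of p2 1 p1 "q j" "1 - q j"] by (auto simp: p_def)
      have lam: "p * lam = q j * p2 * lam2 + (1 - q j) * p1 * lam1"
      proof (cases "p = 0")
        case True
        have "q j * p2 \<ge> 0" "(1 - q j) * p1 \<ge> 0" using q 1 2 by auto
        then have "q j * p2 = 0" "(1 - q j) * p1 = 0" using True unfolding p_def by linarith+
        then show ?thesis using True by auto
      qed (simp add: lam_def)
      have "greedy_val F (q(i := q')) (u(i := u')) (j # l) S
              = (u j + q j * A2 + (1 - q j) * A1) + p * (u' - lam * q')" for q' u'
      proof -
        have "p * (u' - lam * q') = p * u' - (p * lam) * q'" by (simp add: algebra_simps)
        also have "\<dots> = p * u' - (q j * p2 * lam2 + (1 - q j) * p1 * lam1) * q'" by (simp add: lam)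
        finally show ?thesis using feas False by (simp add: e1 e2 p_def algebra_simps)
      qed
      then show ?thesis using p by blast
    qed
  qed
qed

text \<open>Pairs are exchanged one at a time; the price \<open>lam\<close> at which the \<open>i\<close>-th exchange has to be
  profitable is the slope supplied by \<open>greedy_val_affine\<close>, so the hypothesis asks for all prices.\<close>

lemma greedy_val_round:
  assumes "distinct l"
    and q: "\<And>i. i < n \<Longrightarrow> 0 \<le> q i \<and> q i \<le> 1" and l: "set l \<subseteq> {..<n}"
    and X: "\<And>i p. i < n \<Longrightarrow> p \<in> X i \<Longrightarrow> 0 \<le> qf p \<and> qf p \<le> 1"
    and ex: "\<And>i lam. i < n \<Longrightarrow> \<exists>p \<in> X i. u i - lam * q i \<le> uf p - lam * qf p + e"
    and "0 \<le> e"
  shows "\<exists>\<sigma>. (\<forall>i<n. \<sigma> i \<in> X i) \<and>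
           greedy_val F q u l S \<le> greedy_val F (\<lambda>i. qf (\<sigma> i)) (\<lambda>i. uf (\<sigma> i)) l S + real n * e"
proof -
  \<comment> \<open>Hybrid argument: the components below \<open>m\<close> are exchanged, the others
    still abstract. Each exchange loses at most \<open>e\<close> because the slope \<open>p\<close>
    is at most 1.\<close>
  have "\<exists>\<sigma>. (\<forall>i<m. \<sigma> i \<in> X i) \<and>
           greedy_val F q u l S \<le> greedy_val F (\<lambda>i. if i < m then qf (\<sigma> i) else q i)
             (\<lambda>i. if i < m then uf (\<sigma> i) else u i) l S + real m * e" if "m \<le> n" for m
    using that
  proof (induction m)
    case 0
    then show ?case by auto
  next
    case (Suc m)
    then obtain \<sigma> where s: "\<forall>i<m. \<sigma> i \<in> X i" and
      le: "greedy_val F q u l S \<le> greedy_val F (\<lambda>i. if i < m then qf (\<sigma> i) else q i)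
             (\<lambda>i. if i < m then uf (\<sigma> i) else u i) l S + real m * e" by auto
    define q1 where "q1 = (\<lambda>i. if i < m then qf (\<sigma> i) else q i)"
    define u1 where "u1 = (\<lambda>i. if i < m then uf (\<sigma> i) else u i)"
    have q1: "0 \<le> q1 j \<and> q1 j \<le> 1" if "j \<in> set l" for j
    proof -
      have "j < n" using that l by auto
      then show ?thesis using s q[of j] X[of j "\<sigma> j"] by (auto simp: q1_def)
    qed
    obtain A p lam where p: "0 \<le> p" "p \<le> 1"
      and A: "\<And>q' u'. greedy_val F (q1(m := q')) (u1(m := u')) l S = A + p * (u' - lam * q')"
      using greedy_val_affine[where F = F and i = m and u = u1 and S = S and q = q1, OF \<open>distinct l\<close>] q1
      by blast
    obtain x where x: "x \<in> X m" "u m - lam * q m \<le> uf x - lam * qf x + e"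
      using ex[of m lam] Suc.prems by auto
    have "greedy_val F q1 u1 l S = A + p * (u m - lam * q m)"
      using A[of "q m" "u m"] by (simp add: q1_def u1_def fun_upd_idem)
    also have "\<dots> \<le> A + p * (uf x - lam * qf x + e)" using x(2) p by (intro add_left_mono mult_left_mono)
    also have "\<dots> = greedy_val F (q1(m := qf x)) (u1(m := uf x)) l S + p * e"
      by (simp add: A algebra_simps)
    also have "\<dots> \<le> greedy_val F (q1(m := qf x)) (u1(m := uf x)) l S + e"
      using p \<open>0 \<le> e\<close> by (simp add: mult_left_le_one_le)
    also have "q1(m := qf x) = (\<lambda>i. if i < Suc m then qf ((\<sigma>(m := x)) i) else q i)"
      by (auto simp: q1_def fun_eq_iff less_Suc_eq)
    also have "u1(m := uf x) = (\<lambda>i. if i < Suc m then uf ((\<sigma>(m := x)) i) else u i)"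
      by (auto simp: u1_def fun_eq_iff less_Suc_eq)
    finally have "greedy_val F q u l S \<le> greedy_val F (\<lambda>i. if i < Suc m then qf ((\<sigma>(m := x)) i) else q i)
       (\<lambda>i. if i < Suc m then uf ((\<sigma>(m := x)) i) else u i) l S + real (Suc m) * e"
      using le unfolding q1_def u1_def by (simp add: algebra_simps)
    moreover have "\<forall>i<Suc m. (\<sigma>(m := x)) i \<in> X i" using s x by (auto simp: less_Suc_eq)
    ultimately show ?case by blast
  qed
  from this[of n] obtain \<sigma> where s: "\<forall>i<n. \<sigma> i \<in> X i" and
      le: "greedy_val F q u l S \<le> greedy_val F (\<lambda>i. if i < n then qf (\<sigma> i) else q i)
             (\<lambda>i. if i < n then uf (\<sigma> i) else u i) l S + real n * e" by auto
  note le
  also have "greedy_val F (\<lambda>i. if i < n then qf (\<sigma> i) else q i)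
             (\<lambda>i. if i < n then uf (\<sigma> i) else u i) l S = greedy_val F (\<lambda>i. qf (\<sigma> i)) (\<lambda>i. uf (\<sigma> i)) l S"
    using l by (intro greedy_val_cong) auto
  finally show ?thesis using s by blast
qed

text \<open>Membership in the convex hull of the indicator vectors of \<open>F\<close>, expressed dually.\<close>

definition hull_ineqs :: "nat \<Rightarrow> nat set set \<Rightarrow> (nat \<Rightarrow> real) \<Rightarrow> bool" where
  "hull_ineqs n F q \<longleftrightarrow>
     (\<forall>a b. (\<forall>D\<in>F. (\<Sum>i\<in>D. a i) \<le> b) \<longrightarrow> (\<Sum>i<n. a i * q i) \<le> b)"

lemma hull_ineqsD:
  assumes "hull_ineqs n F q" "F \<subseteq> Pow {..<n}" "I \<subseteq> {..<n}"
    and "\<And>D. D \<in> F \<Longrightarrow> (\<Sum>i\<in>D \<inter> I. a i) \<le> b"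
  shows "(\<Sum>i\<in>I. a i * q i) \<le> b"
proof -
  have fin: "finite D" if "D \<in> F" for D
    using that assms(2) finite_subset[of D "{..<n}"] by auto
  have "(\<Sum>i<n. (if i \<in> I then a i else 0) * q i) \<le> b"
    using assms(1)[unfolded hull_ineqs_def, rule_format, of "\<lambda>i. if i \<in> I then a i else 0" b]
      assms(4) fin by (simp add: sum.inter_restrict)
  also have "(\<Sum>i<n. (if i \<in> I then a i else 0) * q i) = (\<Sum>i\<in>{..<n} \<inter> I. a i * q i)"
    unfolding sum.inter_restrict[OF finite_lessThan] by (intro sum.cong) auto
  also have "{..<n} \<inter> I = I" using assms(3) by auto
  finally show ?thesis .
qed

lemma hull_ineqs_nonneg:
  assumes "hull_ineqs n F q" "F \<subseteq> Pow {..<n}" "i < n"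
  shows "0 \<le> q i"
proof -
  have "(\<Sum>i\<in>{i}. (-1) * q i) \<le> 0"
    by (rule hull_ineqsD[OF assms(1,2)]) (use assms(3) in \<open>auto simp: sum_negf\<close>)
  then show ?thesis by simp
qed

lemma hull_ineqs_le_1:
  assumes "hull_ineqs n F q" "F \<subseteq> Pow {..<n}" "i < n"
  shows "q i \<le> 1"
proof -
  have "(\<Sum>i\<in>{i}. 1 * q i) \<le> 1"
  proof (rule hull_ineqsD[OF assms(1,2)])
    fix D show "(\<Sum>j\<in>D \<inter> {i}. 1::real) \<le> 1"
      by (cases "i \<in> D") auto
  qed (use assms(3) in auto)
  then show ?thesis by simp
qed

section \<open>Reduction of weighted greedy bounds to prefixes\<close>

text \<open>Abel summation: nonincreasing nonnegative weights are nonnegative combinations of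
  indicators of prefixes, so unit weights on all prefixes suffice.\<close>

lemma abel_greedy:
  assumes "sorted_wrt (\<lambda>i j. w i \<ge> w j) l" "\<And>i. i \<in> set l \<Longrightarrow> (0::real) \<le> w i"
    and "\<And>m. m \<le> length l \<Longrightarrow> sum_list (map q (take m l)) \<le> c * greedy_val F q q (take m l) S"
  shows "sum_list (map (\<lambda>i. w i * q i) l) \<le> c * greedy_val F q (\<lambda>i. w i * q i) l S"
proof -
  \<comment> \<open>Strengthened for the induction: the weighted surplus is at least
    \<open>b\<close> times the surplus for unit weights, for every nonnegative lower bound
    \<open>b\<close> of the weights. In the end \<open>b = 0\<close>.\<close>
  have "b * (c * greedy_val F q q l S - sum_list (map q l))
          \<le> c * greedy_val F q (\<lambda>i. w i * q i) l S - sum_list (map (\<lambda>i. w i * q i) l)"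
    if "\<forall>i\<in>set l. b \<le> w i" "0 \<le> b" for b
    using assms that
  proof (induction l arbitrary: b rule: rev_induct)
    case Nil
    then show ?case by simp
  next
    case (snoc j l)
    define d where "d = c * greedy_val F q q l S - sum_list (map q l)"
    define P where "P = greedy_ex F q l (\<lambda>T. of_bool (insert j T \<in> F)) S"
    \<comment> \<open>This is the surplus for unit weights of the prefix ending in \<open>j\<close>;
      being nonnegative, it may be weighted by \<open>b\<close> instead of the larger
      \<open>w j\<close>.\<close>
    have d': "0 \<le> d + (c * P - 1) * q j"
      using snoc.prems(3)[of "length (l @ [j])"] by (simp add: greedy_val_snoc d_def P_def algebra_simps)
    have "w j * d \<le> c * greedy_val F q (\<lambda>i. w i * q i) l S - sum_list (map (\<lambda>i. w i * q i) l)"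
      unfolding d_def
    proof (rule snoc.IH)
      show "sorted_wrt (\<lambda>i j. w j \<le> w i) l" "\<And>i. i \<in> set l \<Longrightarrow> 0 \<le> w i" "\<forall>i\<in>set l. w j \<le> w i" "0 \<le> w j"
        using snoc.prems by (auto simp: sorted_wrt_append)
      show "sum_list (map q (take m l)) \<le> c * greedy_val F q q (take m l) S" if "m \<le> length l" for m
        using snoc.prems(3)[of m] that by simp
    qed
    moreover have "b * (d + (c * P - 1) * q j) \<le> w j * (d + (c * P - 1) * q j)"
      using d' snoc.prems by (intro mult_right_mono) auto
    ultimately show ?case by (simp add: greedy_val_snoc d_def P_def algebra_simps)
  qed
  from this[of 0] show ?thesis using assms(2) by auto
qed

section \<open>Blocked items and k-systems\<close>

lemma downward_closedD: "downward_closed F \<Longrightarrow> A \<in> F \<Longrightarrow> B \<subseteq> A \<Longrightarrow> B \<in> F"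
  by (auto simp: downward_closed_def)

text \<open>Selections only grow, and by downward closure a blocked item stays blocked.\<close>

lemma greedy_ex_append_le:
  assumes "downward_closed F" "\<And>i. i \<in> set l' \<Longrightarrow> 0 \<le> q i \<and> q i \<le> 1"
  shows "greedy_ex F q l' (\<lambda>T. of_bool (insert i T \<in> F)) S \<le> of_bool (insert i S \<in> F)"
proof -
  have "greedy_ex F q l' (\<lambda>T. of_bool (insert i T \<in> F)) S \<le> greedy_ex F q l' (\<lambda>_. of_bool (insert i S \<in> F)) S"
  proof (rule greedy_ex_mono)
    show "(of_bool (insert i T \<in> F)::real) \<le> of_bool (insert i S \<in> F)" if "S \<subseteq> T" for T
      using downward_closedD[OF assms(1), of "insert i T" "insert i S"] that by auto
  qed (use assms(2) in auto)
  then show ?thesis by (simp add: greedy_ex_const)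
qed

lemma greedy_ex_compl:
  "greedy_ex F q l (\<lambda>T. (1 - g T) * c) S = c - c * greedy_ex F q l g S"
proof -
  have "(\<lambda>T. (1 - g T) * c) = (\<lambda>T. c * (1 - g T))" by (simp add: mult.commute)
  then show ?thesis by (simp only: greedy_ex_cmult greedy_ex_diff greedy_ex_const) (simp add: right_diff_distrib)
qed

text \<open>An item unblocked at the end was also unblocked at its own turn, when it joined with
  probability \<open>q i\<close>. Selected items count as unblocked, since then
  \<open>insert i T = T\<close>.\<close>

lemma unblocked_le_greedy_val:
  assumes "downward_closed F" "\<And>i. i \<in> set l \<Longrightarrow> 0 \<le> q i \<and> q i \<le> 1"
  shows "sum_list (map (\<lambda>i. q i * greedy_ex F q l (\<lambda>T. of_bool (insert i T \<in> F)) S) l)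
           \<le> greedy_val F q q l S"
  using assms(2)
proof (induction l rule: rev_induct)
  case Nil
  then show ?case by simp
next
  case (snoc j l)
  let ?g = "\<lambda>i T. of_bool (insert i T \<in> F) :: real"
  have le: "greedy_ex F q (l @ [j]) (?g i) S \<le> greedy_ex F q l (?g i) S" for i
    unfolding greedy_ex_append
  proof (rule greedy_ex_mono)
    show "greedy_ex F q [j] (?g i) T \<le> ?g i T" for T
      by (rule greedy_ex_append_le[OF assms(1)]) (use snoc.prems in auto)
  qed (use snoc.prems in auto)
  have "sum_list (map (\<lambda>i. q i * greedy_ex F q (l @ [j]) (?g i) S) l)
          \<le> sum_list (map (\<lambda>i. q i * greedy_ex F q l (?g i) S) l)"
    using snoc.prems le by (intro sum_list_mono mult_left_mono) auto
  also have "\<dots> \<le> greedy_val F q q l S"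
    using snoc by auto
  finally show ?case
    using mult_left_mono[OF le, of "q j" j] snoc.prems[of j] by (simp add: greedy_val_snoc)
qed

lemma k_system_card_le:
  assumes "k_system k n F" "F \<subseteq> Pow {..<n}" "B \<in> maximal_in F S" "D \<in> F" "D \<subseteq> S" "S \<subseteq> {..<n}"
  shows "card D \<le> k * card B"
proof -
  have "finite (Pow S)" using assms(6) finite_subset by auto
  then have finS: "finite {A \<in> F. A \<subseteq> S}" by (rule finite_subset[rotated]) auto
  then have fin: "finite (maximal_in F S)"
    by (rule finite_subset[rotated]) (auto simp: maximal_in_def)
  obtain A where A: "A \<in> {A \<in> F. A \<subseteq> S}" "D \<subseteq> A" and
    mx: "\<And>B. B \<in> {A \<in> F. A \<subseteq> S} \<Longrightarrow> A \<subseteq> B \<Longrightarrow> A = B"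
    using finite_has_maximal2[OF finS, of D] assms(4,5) by auto
  have Amax: "A \<in> maximal_in F S"
    unfolding maximal_in_def using A mx by auto
  have "card D \<le> card A"
    using A assms(6) by (intro card_mono) (auto intro: finite_subset[of A "{..<n}"])
  also have "\<dots> \<le> Max (card ` maximal_in F S)" using fin Amax by (intro Max_ge) auto
  also have "\<dots> \<le> k * Min (card ` maximal_in F S)"
    using assms(1,6) unfolding k_system_def by blast
  also have "\<dots> \<le> k * card B" using fin assms(3) by (intro mult_le_mono2 Min_le) auto
  finally show ?thesis .
qed

lemma greedy_ex_card:
  assumes "distinct l"
  shows "greedy_ex F q l (\<lambda>T. real (card T)) {} = greedy_val F q q l {}"
  using greedy_ex_sum_elements[OF assms, of "{}" F q "\<lambda>_. 1"] by simp

text \<open>Split the mass of \<open>q\<close> according to the final selection \<open>T\<close>.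
  The blocked mass is at most \<open>k * card T\<close>, because \<open>T\<close> is maximal in its
  union with the blocked items; the unblocked mass is at most the greedy value. The two parts give
  the summands \<open>k\<close> and 1.\<close>

lemma k_system_prefix:
  assumes "k_system k n F" "F \<subseteq> Pow {..<n}" "downward_closed F" "{} \<in> F" "hull_ineqs n F q"
    "distinct l" "set l \<subseteq> {..<n}"
  shows "sum_list (map q l) \<le> (real k + 1) * greedy_val F q q l {}"
proof -
  have q: "0 \<le> q i \<and> q i \<le> 1" if "i \<in> set l" for i
    using that assms(7) hull_ineqs_nonneg[OF assms(5,2)] hull_ineqs_le_1[OF assms(5,2)] by auto
  let ?g = "\<lambda>i T. of_bool (insert i T \<in> F) :: real"
  have "greedy_ex F q l (\<lambda>T. \<Sum>i\<in>set l. (1 - ?g i T) * q i) {} \<le> greedy_ex F q l (\<lambda>T. real k * real (card T)) {}"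
  proof (rule greedy_ex_mono)
    fix T assume T: "T \<subseteq> {} \<union> set l" "{} \<in> F \<Longrightarrow> T \<in> F"
    show "(\<Sum>i\<in>set l. (1 - ?g i T) * q i) \<le> real k * real (card T)"
    proof (rule hull_ineqsD[OF assms(5,2,7)])
      fix D assume D: "D \<in> F"
      \<comment> \<open>The items blocked by \<open>T\<close>. By the hull inequality it is enough
        to test a feasible \<open>D\<close>, for which the sum just counts
        \<open>D \<inter> C\<close>.\<close>
      define C where "C = {i \<in> set l. insert i T \<notin> F}"
      have "(\<Sum>i\<in>D \<inter> set l. 1 - ?g i T) = (\<Sum>i\<in>(D \<inter> set l) \<inter> C. 1)"
        by (subst sum.inter_restrict) (auto simp: C_def intro!: sum.cong)
      also have "\<dots> = real (card (D \<inter> C))" by (auto simp: C_def Int_assoc intro!: arg_cong[of _ _ card])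
      also have "card (D \<inter> C) \<le> k * card T"
      proof (rule k_system_card_le[OF assms(1,2), where S = "T \<union> C"])
        show "T \<in> maximal_in F (T \<union> C)"
          unfolding maximal_in_def
        proof (intro CollectI conjI ballI impI)
          fix B assume B: "B \<in> F" "T \<subseteq> B \<and> B \<subseteq> T \<union> C"
          show "B = T"
          proof (rule ccontr)
            assume "B \<noteq> T"
            then obtain x where "x \<in> B" "x \<in> C" using B by auto
            then have "insert x T \<in> F" using downward_closedD[OF assms(3) B(1), of "insert x T"] B by auto
            then show False using \<open>x \<in> C\<close> by (auto simp: C_def)
          qed
        qed (use T assms(4) in auto)
        show "D \<inter> C \<in> F" using downward_closedD[OF assms(3) D] by auto
        show "T \<union> C \<subseteq> {..<n}" using T assms(7) by (auto simp: C_def)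
      qed auto
      finally show "(\<Sum>i\<in>D \<inter> set l. 1 - ?g i T) \<le> real k * real (card T)"
        by (simp flip: of_nat_mult)
    qed
  qed (use q in auto)
  also have "greedy_ex F q l (\<lambda>T. real k * real (card T)) {} = real k * greedy_val F q q l {}"
    by (simp add: greedy_ex_cmult greedy_ex_card assms(6))
  also have "greedy_ex F q l (\<lambda>T. \<Sum>i\<in>set l. (1 - ?g i T) * q i) {}
              = (\<Sum>i\<in>set l. q i) - (\<Sum>i\<in>set l. q i * greedy_ex F q l (?g i) {})"
    by (simp only: greedy_ex_sum greedy_ex_compl sum_subtractf)
  finally have "(\<Sum>i\<in>set l. q i) - (\<Sum>i\<in>set l. q i * greedy_ex F q l (?g i) {}) \<le> real k * greedy_val F q q l {}" .
  moreover have "(\<Sum>i\<in>set l. q i * greedy_ex F q l (?g i) {}) \<le> greedy_val F q q l {}"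
    using unblocked_le_greedy_val[where q = q and l = l and S = "{}", OF assms(3) q] by (simp add: sum_list_distinct_conv_sum_set assms(6))
  ultimately show ?thesis
    by (simp add: sum_list_distinct_conv_sum_set assms(6) distrib_right)
qed

section \<open>Matroid rank and its multilinear extension\<close>

definition mrank :: "nat set set \<Rightarrow> nat set \<Rightarrow> nat" where
  "mrank F A = Max (card ` {B \<in> F. B \<subseteq> A})"

lemma matroid_card_le_mrank:
  assumes "matroid_indep n F" "B \<in> F" "B \<subseteq> A"
  shows "card B \<le> mrank F A"
proof -
  have "finite F" using assms(1) by (auto simp: matroid_indep_def intro: finite_subset[of F "Pow {..<n}"])
  then show ?thesis unfolding mrank_def using assms by (intro Max_ge) auto
qed

lemma mrank_attained:
  assumes "matroid_indep n F"
  shows "\<exists>B \<in> F. B \<subseteq> A \<and> card B = mrank F A"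
proof -
  have "finite F" using assms(1) by (auto simp: matroid_indep_def intro: finite_subset[of F "Pow {..<n}"])
  then have "Max (card ` {B \<in> F. B \<subseteq> A}) \<in> card ` {B \<in> F. B \<subseteq> A}"
    using assms by (intro Max_in) (auto simp: matroid_indep_def)
  then show ?thesis unfolding mrank_def by auto
qed

lemma mrank_mono:
  assumes "matroid_indep n F" "A \<subseteq> A'"
  shows "mrank F A \<le> mrank F A'"
proof -
  obtain B where "B \<in> F" "B \<subseteq> A" "card B = mrank F A" using mrank_attained[OF assms(1)] by blast
  then show ?thesis using matroid_card_le_mrank[OF assms(1), of B A'] assms(2) by auto
qed

lemma matroid_finite: "matroid_indep n F \<Longrightarrow> A \<in> F \<Longrightarrow> finite A"
  using finite_subset[of A "{..<n}"] by (auto simp: matroid_indep_def)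

text \<open>A largest independent set between \<open>B\<close> and \<open>B \<union> D\<close>
  works: if it were smaller than \<open>D\<close>, an exchange would enlarge it.\<close>

lemma matroid_augment:
  assumes "matroid_indep n F" "B \<in> F" "D \<in> F"
  shows "\<exists>B' \<in> F. B \<subseteq> B' \<and> B' \<subseteq> B \<union> D \<and> card D \<le> card B'"
proof -
  let ?P = "\<lambda>B'. B' \<in> F \<and> B \<subseteq> B' \<and> B' \<subseteq> B \<union> D"
  have "?P B" using assms by auto
  moreover have "card B' < Suc n" if "?P B'" for B'
  proof -
    have "B' \<subseteq> {..<n}" using that assms(1) by (auto simp: matroid_indep_def)
    then show ?thesis using card_mono[of "{..<n}" B'] by auto
  qed
  ultimately obtain B' where B': "?P B'" and mx: "\<And>C. ?P C \<Longrightarrow> card C \<le> card B'"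
    using ex_has_greatest_nat[of ?P B card "Suc n"] by blast
  have "card D \<le> card B'"
  proof (rule ccontr)
    assume "\<not> ?thesis"
    then obtain x where x: "x \<in> D - B'" "insert x B' \<in> F"
      using assms(1) B' \<open>D \<in> F\<close> unfolding matroid_indep_def by (meson linorder_not_le)
    have "card (insert x B') \<le> card B'" using x B' by (intro mx) auto
    then show False using x B' matroid_finite[OF assms(1), of B'] by auto
  qed
  then show ?thesis using B' by blast
qed

lemma maximal_in_card_mrank:
  assumes "matroid_indep n F" "S \<in> maximal_in F A"
  shows "card S = mrank F A"
proof -
  have S: "S \<in> F" "S \<subseteq> A" and mx: "\<And>B. B \<in> F \<Longrightarrow> S \<subseteq> B \<Longrightarrow> B \<subseteq> A \<Longrightarrow> B = S"
    using assms(2) by (auto simp: maximal_in_def)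
  obtain D where D: "D \<in> F" "D \<subseteq> A" "card D = mrank F A" using mrank_attained[OF assms(1)] by blast
  obtain B' where "B' \<in> F" "S \<subseteq> B'" "B' \<subseteq> S \<union> D" "card D \<le> card B'"
    using matroid_augment[OF assms(1) S(1) D(1)] by blast
  then have "card D \<le> card S" using mx[of B'] S D by auto
  then show ?thesis using D matroid_card_le_mrank[OF assms(1) S] by auto
qed

text \<open>Extend a basis \<open>B\<close> of \<open>T\<close> by elements of \<open>D\<close> to
  an independent set of size at least \<open>card D\<close>. Each of the at least
  \<open>card D - mrank F T\<close> new elements raises the rank of \<open>T\<close>, and the
  remaining marginals are nonnegative.\<close>

lemma mrank_marginals:
  assumes "matroid_indep n F" "D \<in> F"
  shows "(\<Sum>j\<in>D. 1 - (real (mrank F (insert j T)) - real (mrank F T))) \<le> mrank F T"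
proof -
  have dc: "downward_closed F" using assms(1) by (auto simp: matroid_indep_def)
  obtain B where B: "B \<in> F" "B \<subseteq> T" "card B = mrank F T" using mrank_attained[OF assms(1)] by blast
  obtain B' where B': "B' \<in> F" "B \<subseteq> B'" "B' \<subseteq> B \<union> D" "card D \<le> card B'"
    using matroid_augment[OF assms(1) B(1) assms(2)] by blast
  have fin: "finite B'" "finite D" using matroid_finite[OF assms(1)] B' assms(2) by auto
  have "1 \<le> real (mrank F (insert j T)) - real (mrank F T)" if "j \<in> B' - B" for j
  proof -
    have "insert j B \<in> F" using downward_closedD[OF dc B'(1), of "insert j B"] B' that by auto
    then have "card (insert j B) \<le> mrank F (insert j T)"
      using B by (intro matroid_card_le_mrank[OF assms(1)]) auto
    then show ?thesis using that B B' fin finite_subset[of B B'] by auto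
  qed
  then have "real (card (B' - B)) \<le> (\<Sum>j\<in>B' - B. real (mrank F (insert j T)) - real (mrank F T))"
    using sum_mono[of "B' - B" "\<lambda>_. 1::real"] by simp
  also have "\<dots> \<le> (\<Sum>j\<in>D. real (mrank F (insert j T)) - real (mrank F T))"
    using fin B' mrank_mono[OF assms(1), of T "insert _ T"] by (intro sum_mono2) auto
  finally show ?thesis
    using B' B card_Diff_subset[of B B'] finite_subset[OF B'(2) fin(1)] card_mono[OF fin(1) B'(2)]
    by (simp add: sum_subtractf)
qed

text \<open>Invariant of the greedy run on a matroid: the selection remains a maximal independent
  subset of the items offered so far.\<close>

lemma maximal_in_insert:
  assumes "downward_closed F" "S \<in> maximal_in F A"
  shows "(if insert j S \<in> F then insert j S else S) \<in> maximal_in F (insert j A)"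
proof -
  have S: "S \<in> F" "S \<subseteq> A" and mx: "\<And>B. B \<in> F \<Longrightarrow> S \<subseteq> B \<Longrightarrow> B \<subseteq> A \<Longrightarrow> B = S"
    using assms(2) by (auto simp: maximal_in_def)
  have *: "B - {j} \<subseteq> S" if "B \<in> F" "S \<subseteq> B" "B \<subseteq> insert j A" for B
  proof -
    have "B \<inter> A \<in> F" using downward_closedD[OF assms(1) that(1)] by auto
    then have "B \<inter> A = S" using that S by (intro mx) auto
    then show ?thesis using that by auto
  qed
  have 1: "B = S" if "B \<in> F" "S \<subseteq> B" "B \<subseteq> insert j A" "insert j S \<notin> F" for B
  proof -
    have "j \<notin> B" using that downward_closedD[OF assms(1) that(1), of "insert j S"] by auto
    then show ?thesis using *[OF that(1-3)] that by auto
  qed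
  have 2: "B = insert j S" if "B \<in> F" "insert j S \<subseteq> B" "B \<subseteq> insert j A" for B
    using * that by blast
  show ?thesis
  proof (cases "insert j S \<in> F")
    case True
    then have "insert j S \<in> maximal_in F (insert j A)"
      using S 2 unfolding maximal_in_def by blast
    then show ?thesis using True by simp
  next
    case False
    then have "S \<in> maximal_in F (insert j A)"
      using S 1 unfolding maximal_in_def by blast
    then show ?thesis using False by simp
  qed
qed

text \<open>Coupling with the run over \<open>UNIV\<close>, which keeps every item whose coin
  succeeds: under the same coins the greedy selection is a basis of that set.\<close>

lemma greedy_ex_mrank:
  assumes "matroid_indep n F" "S \<in> maximal_in F A"
  shows "greedy_ex F q l (\<lambda>T. real (card T)) S = greedy_ex UNIV q l (\<lambda>T. real (mrank F T)) A"
  using assms(2)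
proof (induction l arbitrary: S A)
  case Nil
  then show ?case using maximal_in_card_mrank[OF assms(1)] by simp
next
  case (Cons j l)
  have "downward_closed F" using assms(1) by (auto simp: matroid_indep_def)
  note m = maximal_in_insert[OF this Cons.prems, of j]
  show ?case
    using Cons.IH[OF Cons.prems] Cons.IH[OF m] by (auto simp: algebra_simps)
qed

lemma greedy_ex_UNIV_insert:
  "greedy_ex UNIV q l f (insert j A) = greedy_ex UNIV q l (\<lambda>T. f (insert j T)) A"
proof (induction l arbitrary: A)
  case (Cons a l)
  show ?case using Cons[of A] Cons[of "insert a A"] by (simp add: insert_commute[of a j])
qed simp

text \<open>The derivative along the ray is the sum of \<open>q j\<close> times the partial
  derivatives. Each of these compares \<open>j\<close> forced in with \<open>j\<close> forced out,
  and for monotone \<open>f\<close> this dominates the marginal with \<open>j\<close> left to its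
  coin.\<close>

lemma multilinear_deriv:
  assumes f: "\<And>A j. f A \<le> f (insert j A)" and t: "0 \<le> t" "t \<le> 1"
    and "\<And>i. i \<in> set l \<Longrightarrow> 0 \<le> q i \<and> q i \<le> 1"
  shows "\<exists>h'. ((\<lambda>t. greedy_ex UNIV (\<lambda>i. t * q i) l f A) has_field_derivative h') (at t) \<and>
     sum_list (map (\<lambda>j. q j * greedy_ex UNIV (\<lambda>i. t * q i) l (\<lambda>T. f (insert j T) - f T) A) l) \<le> h'"
  using assms(4)
proof (induction l arbitrary: A)
  case Nil
  show ?case by (intro exI[of _ 0]) simp
next
  case (Cons j l)
  let ?H = "\<lambda>A t. greedy_ex UNIV (\<lambda>i. t * q i) l f A"
  let ?m = "\<lambda>l j A. greedy_ex UNIV (\<lambda>i. t * q i) l (\<lambda>T. f (insert j T) - f T) A"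
  obtain h1 where h1: "(?H A has_field_derivative h1) (at t)" "sum_list (map (\<lambda>j. q j * ?m l j A) l) \<le> h1"
    using Cons.IH[of A] Cons.prems by auto
  obtain h2 where h2: "(?H (insert j A) has_field_derivative h2) (at t)"
      "sum_list (map (\<lambda>i. q i * ?m l i (insert j A)) l) \<le> h2"
    using Cons.IH[of "insert j A"] Cons.prems by auto
  have qj: "0 \<le> q j" "q j \<le> 1" "0 \<le> t * q j" "t * q j \<le> 1"
    using Cons.prems[of j] t mult_le_one[of t "q j"] by auto
  define h' where "h' = q j * (?H (insert j A) t - ?H A t) + t * q j * h2 + (1 - t * q j) * h1"
  have "((\<lambda>t. greedy_ex UNIV (\<lambda>i. t * q i) (j # l) f A) has_field_derivative h') (at t)"
    unfolding greedy_ex.simps by (auto intro!: derivative_eq_intros h1(1) h2(1) simp: h'_def algebra_simps)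
  moreover have "sum_list (map (\<lambda>i. q i * ?m (j # l) i A) (j # l)) \<le> h'"
  proof -
    have eq: "?m l j A = ?H (insert j A) t - ?H A t" "?m l j (insert j A) = 0"
      by (simp_all add: greedy_ex_diff greedy_ex_UNIV_insert)
    have "0 \<le> ?m l j A"
    proof -
      have "greedy_ex UNIV (\<lambda>i. t * q i) l (\<lambda>_. 0) A \<le> ?m l j A"
      proof (rule greedy_ex_mono)
        show "0 \<le> t * q i \<and> t * q i \<le> 1" if "i \<in> set l" for i
          using Cons.prems[of i] that t mult_le_one[of t "q i"] by auto
      qed (use f in auto)
      then show ?thesis by (simp add: greedy_ex_const)
    qed
    \<comment> \<open>Leaving \<open>j\<close> to its coin scales its marginal by
      \<open>1 - t * q j\<close>, since the marginal vanishes once \<open>j\<close> is present. Here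
      that factor is lost.\<close>
    then have 1: "q j * ?m (j # l) j A \<le> q j * (?H (insert j A) t - ?H A t)"
      using qj eq by (intro mult_left_mono) (auto simp: mult_left_le_one_le)
    have lin: "sum_list (map (\<lambda>i. q i * (c * X i + d * Y i)) l) =
        c * sum_list (map (\<lambda>i. q i * X i) l) + d * sum_list (map (\<lambda>i. q i * Y i) l)" for c d X Y
      by (induction l) (auto simp: algebra_simps)
    have "sum_list (map (\<lambda>i. q i * ?m (j # l) i A) l) =
       t * q j * sum_list (map (\<lambda>i. q i * ?m l i (insert j A)) l)
        + (1 - t * q j) * sum_list (map (\<lambda>i. q i * ?m l i A) l)"
      by (simp add: lin)
    also have "\<dots> \<le> t * q j * h2 + (1 - t * q j) * h1"
      using qj h1 h2 by (intro add_mono mult_left_mono) auto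
    finally show ?thesis using 1 unfolding h'_def list.map sum_list.Cons by linarith
  qed
  ultimately show ?case by blast
qed

text \<open>The correlation gap: for the multilinear extension \<open>h\<close> of the rank function along the ray
  \<open>t q\<close> one has \<open>h'(t) \<ge> \<Sum> q - h(t)\<close>; integrate from 0 to 1.\<close>

lemma matroid_prefix:
  assumes "matroid_indep n F" "hull_ineqs n F q" "distinct l" "set l \<subseteq> {..<n}"
  shows "sum_list (map q l) \<le> exp 1 / (exp 1 - 1) * greedy_val F q q l {}"
proof -
  have F: "F \<subseteq> Pow {..<n}" "{} \<in> F" "downward_closed F" using assms(1) by (auto simp: matroid_indep_def)
  have q: "0 \<le> q i \<and> q i \<le> 1" if "i \<in> set l" for i
    using that assms(4) hull_ineqs_nonneg[OF assms(2) F(1)] hull_ineqs_le_1[OF assms(2) F(1)] by auto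
  define f where "f = (\<lambda>T. real (mrank F T))"
  define h where "h = (\<lambda>t. greedy_ex UNIV (\<lambda>i. t * q i) l f {})"
  define Q where "Q = sum_list (map q l)"
  have Q: "Q = (\<Sum>i\<in>set l. q i)" unfolding Q_def by (simp add: sum_list_distinct_conv_sum_set assms(3))
  have f: "f A \<le> f (insert j A)" for A j using mrank_mono[OF assms(1), of A "insert j A"] by (auto simp: f_def)
  have deriv: "\<exists>h'. (h has_field_derivative h') (at t) \<and> Q - h t \<le> h'" if t: "0 \<le> t" "t \<le> 1" for t
  proof -
    let ?E = "\<lambda>g. greedy_ex UNIV (\<lambda>i. t * q i) l g {}"
    obtain h' where h': "(h has_field_derivative h') (at t)"
       "sum_list (map (\<lambda>j. q j * ?E (\<lambda>T. f (insert j T) - f T)) l) \<le> h'"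
      using multilinear_deriv[where f = f and t = t and l = l and q = q and A = "{}", OF f t q]
      unfolding h_def by blast
    \<comment> \<open>For each outcome \<open>T\<close>, \<open>mrank_marginals\<close> is an
      inequality about all feasible \<open>D\<close>, so it passes to the point \<open>q\<close> of
      the hull.\<close>
    have "?E (\<lambda>T. \<Sum>j\<in>set l. (1 - (f (insert j T) - f T)) * q j) \<le> ?E f"
    proof (rule greedy_ex_mono)
      fix T
      show "(\<Sum>j\<in>set l. (1 - (f (insert j T) - f T)) * q j) \<le> f T"
      proof (rule hull_ineqsD[OF assms(2) F(1) assms(4)])
        fix D assume "D \<in> F"
        then have "D \<inter> set l \<in> F" using downward_closedD[OF F(3)] by auto
        then show "(\<Sum>j\<in>D \<inter> set l. 1 - (f (insert j T) - f T)) \<le> f T"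
          unfolding f_def by (rule mrank_marginals[OF assms(1)])
      qed
    next
      show "0 \<le> t * q i \<and> t * q i \<le> 1" if "i \<in> set l" for i
        using q[OF that] t mult_le_one[of t "q i"] by auto
    qed
    also have "?E (\<lambda>T. \<Sum>j\<in>set l. (1 - (f (insert j T) - f T)) * q j) =
       Q - (\<Sum>j\<in>set l. q j * ?E (\<lambda>T. f (insert j T) - f T))"
      unfolding Q by (simp only: greedy_ex_sum greedy_ex_compl sum_subtractf)
    finally show ?thesis using h' by (auto simp: sum_list_distinct_conv_sum_set assms(3) h_def)
  qed
  \<comment> \<open>The integrating factor \<open>exp t\<close> turns the differential inequality
    into monotonicity of \<open>exp t * (h t - Q)\<close>.\<close>
  have "exp 0 * (h 0 - Q) \<le> exp 1 * (h 1 - Q)"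
  proof (rule DERIV_nonneg_imp_nondecreasing[of 0 1 "\<lambda>t. exp t * (h t - Q)"])
    fix t :: real assume t: "0 \<le> t" "t \<le> 1"
    obtain h' where h': "(h has_field_derivative h') (at t)" "Q - h t \<le> h'" using deriv[OF t] by blast
    have "((\<lambda>t. exp t * (h t - Q)) has_field_derivative exp t * (h t - Q + h')) (at t)"
      by (auto intro!: derivative_eq_intros h' simp: algebra_simps)
    then show "\<exists>y. ((\<lambda>t. exp t * (h t - Q)) has_real_derivative y) (at t) \<and> 0 \<le> y"
      using h' by (intro exI conjI) auto
  qed auto
  moreover have "0 \<le> h 0"
  proof -
    have "greedy_ex UNIV (\<lambda>i. 0 * q i) l (\<lambda>_. 0) {} \<le> h 0"
      unfolding h_def by (rule greedy_ex_mono) (auto simp: f_def)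
    then show ?thesis by (simp add: greedy_ex_const)
  qed
  ultimately have "(exp 1 - 1) * Q \<le> exp 1 * h 1" by (simp add: algebra_simps)
  moreover have "h 1 = greedy_val F q q l {}"
  proof -
    have "{} \<in> maximal_in F {}" using F by (auto simp: maximal_in_def)
    from greedy_ex_mrank[OF assms(1) this, of q l]
    show ?thesis using greedy_ex_card[OF assms(3), of F q] unfolding h_def f_def by simp
  qed
  moreover have "exp 1 > (1::real)" by simp
  ultimately show ?thesis unfolding Q_def by (simp add: field_simps)
qed

section \<open>Choice of the order and of the scaling factors\<close>

text \<open>Items without positive utility are dropped and the others sorted by decreasing density,
  as \<open>abel_greedy\<close> requires. The bound by \<open>C * q i\<close> forces
  \<open>q i > 0\<close> where \<open>u i > 0\<close>. Nothing is scaled, so \<open>r\<close> is 1;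
  it gives the conclusion the form shared with knapsacks.\<close>

lemma greedy_by_density:
  assumes "F \<subseteq> Pow {..<n}" "hull_ineqs n F q" "\<And>i. i < n \<Longrightarrow> u i \<le> C * q i" "0 \<le> C"
    and pre: "\<And>l. distinct l \<Longrightarrow> set l \<subseteq> {..<n} \<Longrightarrow> sum_list (map q l) \<le> c * greedy_val F q q l {}"
  shows "\<exists>l r. distinct l \<and> set l \<subseteq> {..<n} \<and> (\<forall>i<n. 0 \<le> r i \<and> r i \<le> 1) \<and>
     (\<Sum>i<n. u i) \<le> c * greedy_val F (\<lambda>i. r i * q i) (\<lambda>i. r i * u i) l {}"
proof -
  define I where "I = {i. i < n \<and> 0 < u i}"
  define l where "l = sort_key (\<lambda>i. - (u i / q i)) (sorted_list_of_set I)"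
  have fin: "finite I" by (auto simp: I_def)
  have l: "distinct l" "set l = I" using fin by (auto simp: l_def)
  have qpos: "0 < q i" if "i \<in> I" for i
  proof -
    have "q i \<ge> 0" "q i \<noteq> 0"
      using that assms(3)[of i] hull_ineqs_nonneg[OF assms(2,1), of i] by (auto simp: I_def)
    then show ?thesis by auto
  qed
  have "(\<Sum>i<n. u i) \<le> (\<Sum>i<n. if i \<in> I then u i else 0)" by (intro sum_mono) (auto simp: I_def)
  also have "\<dots> = (\<Sum>i\<in>{..<n} \<inter> I. u i)" by (rule sum.inter_restrict[symmetric]) simp
  also have "{..<n} \<inter> I = set l" by (auto simp: l I_def)
  also have "(\<Sum>i\<in>set l. u i) = sum_list (map (\<lambda>i. (u i / q i) * q i) l)"
    by (simp add: sum_list_distinct_conv_sum_set l) (rule sum.cong, auto dest: qpos)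
  also have "\<dots> \<le> c * greedy_val F q (\<lambda>i. (u i / q i) * q i) l {}"
  proof (rule abel_greedy)
    have "sorted (map (\<lambda>i. - (u i / q i)) l)" unfolding l_def by (rule sorted_sort_key)
    then show "sorted_wrt (\<lambda>i j. u j / q j \<le> u i / q i) l" by (simp add: sorted_wrt_map)
    show "0 \<le> u i / q i" if "i \<in> set l" for i using that qpos[of i] by (auto simp: l I_def)
    show "sum_list (map q (take m l)) \<le> c * greedy_val F q q (take m l) {}" for m
    proof (rule pre)
      have "set (take m l) \<subseteq> set l" by (rule set_take_subset)
      then show "set (take m l) \<subseteq> {..<n}" by (auto simp: l I_def)
    qed (use l in auto)
  qed
  also have "greedy_val F q (\<lambda>i. (u i / q i) * q i) l {} = greedy_val F (\<lambda>i. 1 * q i) (\<lambda>i. 1 * u i) l {}"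
    by (intro greedy_val_cong) (auto simp: l dest: qpos)
  finally show ?thesis
    by (intro exI[of _ l] exI[of _ "\<lambda>_. 1"]) (use l in \<open>auto simp: I_def\<close>)
qed

text \<open>Processing the items by decreasing size and scaling each one so that it is reached with
  probability exactly 1/3; Markov's inequality bounds the probability of being blocked by 2/3.\<close>

lemma knapsack_greedy:
  assumes "knapsack n F" "hull_ineqs n F q"
  shows "\<exists>l r. distinct l \<and> set l \<subseteq> {..<n} \<and> (\<forall>i<n. 0 \<le> r i \<and> r i \<le> 1) \<and>
     (\<Sum>i<n. u i) = 3 * greedy_val F (\<lambda>i. r i * q i) (\<lambda>i. r i * u i) l {}"
proof -
  obtain sz :: "nat \<Rightarrow> real" where sz: "\<And>i. i < n \<Longrightarrow> 0 \<le> sz i \<and> sz i \<le> 1"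
    and F: "F = {S. S \<subseteq> {..<n} \<and> (\<Sum>i\<in>S. sz i) \<le> 1}"
    using assms(1) by (auto simp: knapsack_def)
  have FP: "F \<subseteq> Pow {..<n}" by (auto simp: F)
  have finF: "finite D" if "D \<in> F" for D using that by (auto simp: F intro: finite_subset[of D "{..<n}"])
  note q0 = hull_ineqs_nonneg[OF assms(2) FP] and q1 = hull_ineqs_le_1[OF assms(2) FP]
  define l where "l = sort_key (\<lambda>i. - sz i) [0..<n]"
  have l: "distinct l" "set l = {..<n}" by (auto simp: l_def)
  have "sorted (map (\<lambda>i. - sz i) l)" unfolding l_def by (rule sorted_sort_key)
  then have sorted: "sorted_wrt (\<lambda>i j. sz j \<le> sz i) l" by (simp add: sorted_wrt_map)
  \<comment> \<open>One \<open>r\<close> has to serve all rewards \<open>a\<close>: the expected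
    load of the selection is obtained by taking \<open>a i * q i\<close> as reward.\<close>
  have "\<exists>r. (\<forall>i<n. 0 \<le> r i \<and> r i \<le> 1) \<and>
     (\<forall>a. 3 * greedy_val F (\<lambda>i. r i * q i) (\<lambda>i. r i * a i) l {} = sum_list (map a l))"
    if "sorted_wrt (\<lambda>i j. sz j \<le> sz i) l" "distinct l" "set l \<subseteq> {..<n}" for l
    using that
  proof (induction l rule: rev_induct)
    case Nil
    then show ?case by (intro exI[of _ "\<lambda>_. 0"]) auto
  next
    case (snoc j l)
    obtain r where r: "\<And>i. i < n \<Longrightarrow> 0 \<le> r i \<and> r i \<le> 1" and
      val: "\<And>a. 3 * greedy_val F (\<lambda>i. r i * q i) (\<lambda>i. r i * a i) l {} = sum_list (map a l)"
      using snoc.IH snoc.prems by (auto simp: sorted_wrt_append)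
    define q' where "q' = (\<lambda>i. r i * q i)"
    have jl: "j < n" "j \<notin> set l" "distinct l" "set l \<subseteq> {..<n}" using snoc.prems by auto
    have q': "0 \<le> q' i \<and> q' i \<le> 1" if "i \<in> set l" for i
      using that jl r[of i] q0[of i] q1[of i] mult_le_one[of "r i" "q i"] by (auto simp: q'_def)
    define P where "P = greedy_ex F q' l (\<lambda>T. of_bool (insert j T \<in> F)) {}"
    have load: "3 * greedy_ex F q' l (\<lambda>T. \<Sum>i\<in>T. a i) {} = (\<Sum>i\<in>set l. a i * q i)" for a
      using greedy_ex_sum_elements[OF jl(3), of "{}" F q' a] val[of "\<lambda>i. a i * q i"]
      by (simp add: q'_def mult.left_commute sum_list_distinct_conv_sum_set jl)
    have "1 - P \<le> 2/3"
    proof -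
      \<comment> \<open>Weight for Markov's inequality: a \<open>T\<close> blocking \<open>j\<close>
        weighs at least 1, and the earlier items of a feasible set weigh at most 2. If
        \<open>sz j > 1/2\<close>, earlier items are larger than 1/2 too and are counted; otherwise
        a blocking load exceeds 1/2, hence the factor 2.\<close>
      define a where "a = (\<lambda>i. if sz j > 1/2 then 1 else 2 * sz i)"
      have "1 - P = greedy_ex F q' l (\<lambda>T. 1 - of_bool (insert j T \<in> F)) {}"
        by (simp add: greedy_ex_diff greedy_ex_const P_def)
      also have "\<dots> \<le> greedy_ex F q' l (\<lambda>T. \<Sum>i\<in>T. a i) {}"
      proof (rule greedy_ex_mono)
        fix T assume T: "T \<subseteq> {} \<union> set l" "{} \<in> F \<Longrightarrow> T \<in> F"
        have fin: "finite T" using T finite_subset by auto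
        have szT: "0 \<le> sz i" if "i \<in> T" for i using that T jl sz by auto
        have a0: "0 \<le> a i" if "i \<in> T" for i using szT[OF that] by (auto simp: a_def)
        show "1 - of_bool (insert j T \<in> F) \<le> (\<Sum>i\<in>T. a i)"
        proof (cases "insert j T \<in> F")
          case True
          then show ?thesis using a0 by (auto intro: sum_nonneg)
        next
          case False
          then have big: "sz j + (\<Sum>i\<in>T. sz i) > 1"
            using T jl fin unfolding F by (subst (asm) mem_Collect_eq, subst (asm) sum.insert) auto
          show ?thesis
          proof (cases "sz j > 1/2")
            case True
            have "T \<noteq> {}" using big sz[OF jl(1)] by auto
            then have "card T \<ge> 1" using fin by (simp add: Suc_leI card_gt_0_iff)
            then show ?thesis using True False by (simp add: a_def)
          next
            case False
            then have "2 * (\<Sum>i\<in>T. sz i) \<ge> 1" using big by auto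
            then show ?thesis using False by (simp add: a_def sum_distrib_left)
          qed
        qed
      qed (use q' in auto)
      also have "\<dots> = (\<Sum>i\<in>set l. a i * q i) / 3" using load[of a] by simp
      also have "(\<Sum>i\<in>set l. a i * q i) \<le> 2"
      proof (rule hull_ineqsD[OF assms(2) FP jl(4)])
        fix D assume D: "D \<in> F"
        have szD: "(\<Sum>i\<in>D \<inter> set l. sz i) \<le> 1"
        proof -
          have "(\<Sum>i\<in>D \<inter> set l. sz i) \<le> (\<Sum>i\<in>D. sz i)"
          proof (rule sum_mono2)
            show "0 \<le> sz i" if "i \<in> D - D \<inter> set l" for i using that D FP sz by auto
          qed (use D finF in auto)
          also have "\<dots> \<le> 1" using D unfolding F by simp
          finally show ?thesis .
        qed
        show "(\<Sum>i\<in>D \<inter> set l. a i) \<le> 2"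
        proof (cases "sz j > 1/2")
          case True
          have "(\<Sum>i\<in>D \<inter> set l. 1/2) \<le> (\<Sum>i\<in>D \<inter> set l. sz i)"
            using True snoc.prems(1) by (intro sum_mono) (auto simp: sorted_wrt_append)
          then show ?thesis using True szD by (simp add: a_def)
        next
          case False
          then show ?thesis using szD by (simp add: a_def sum_distrib_left[symmetric])
        qed
      qed
      finally show ?thesis by simp
    qed
    then have P: "1/3 \<le> P" by simp
    \<comment> \<open>\<open>P\<close> is the probability that \<open>j\<close> still fits, so this
      factor makes the product exactly 1/3; it is at most 1 by the bound on
      \<open>P\<close>.\<close>
    define r' where "r' = r(j := 1 / (3 * P))"
    have "0 \<le> r' i \<and> r' i \<le> 1" if "i < n" for i
      using r[OF that] P by (auto simp: r'_def field_simps)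
    moreover have "3 * greedy_val F (\<lambda>i. r' i * q i) (\<lambda>i. r' i * a i) (l @ [j]) {} = sum_list (map a (l @ [j]))" for a
    proof -
      have "greedy_ex F (\<lambda>i. r' i * q i) l (\<lambda>T. of_bool (insert j T \<in> F)) {} = P"
        unfolding P_def q'_def using jl by (intro greedy_ex_cong) (auto simp: r'_def)
      moreover have "greedy_val F (\<lambda>i. r' i * q i) (\<lambda>i. r' i * a i) l {}
          = greedy_val F (\<lambda>i. r i * q i) (\<lambda>i. r i * a i) l {}"
        using jl by (intro greedy_val_cong) (auto simp: r'_def)
      ultimately show ?thesis using val[of a] P by (simp add: greedy_val_snoc r'_def field_simps)
    qed
    ultimately show ?case by blast
  qed
  from this[OF sorted] l obtain r where r: "\<forall>i<n. 0 \<le> r i \<and> r i \<le> 1"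
    and v: "3 * greedy_val F (\<lambda>i. r i * q i) (\<lambda>i. r i * u i) l {} = sum_list (map u l)" by auto
  have "sum_list (map u l) = (\<Sum>i<n. u i)" by (simp add: sum_list_distinct_conv_sum_set l)
  then show ?thesis using r v l by (intro exI[of _ l] exI[of _ r]) auto
qed

section \<open>Splitting a policy into its components\<close>

lemma pmf_expectation_cong:
  fixes f g :: "'b \<Rightarrow> real"
  assumes "\<And>x. x \<in> set_pmf p \<Longrightarrow> f x = g x"
  shows "measure_pmf.expectation p f = measure_pmf.expectation p g"
  by (rule integral_cong_AE) (use assms in \<open>auto simp: AE_measure_pmf_iff\<close>)

text \<open>\<open>U\<close> and \<open>Q\<close> are chosen before the test \<open>z\<close>, so a
  single split meets the bounds at all prices at once. The bound \<open>U i \<le> C * Q i\<close>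
  gives densities a meaning and, in averages, makes \<open>U\<close> integrable.\<close>

definition split_val :: "nat \<Rightarrow> nat set set \<Rightarrow> real \<Rightarrow> (nat \<Rightarrow> 'z \<Rightarrow> bool) \<Rightarrow> ('z \<Rightarrow> real)
    \<Rightarrow> (nat \<Rightarrow> 'z \<Rightarrow> real) \<Rightarrow> real \<Rightarrow> bool" where
  "split_val n F C G lam B v \<longleftrightarrow> (\<exists>U Q. v = (\<Sum>i<n. U i) \<and> hull_ineqs n F Q \<and>
     (\<forall>i<n. U i \<le> C * Q i) \<and> (\<forall>i<n. \<forall>z. G i z \<longrightarrow> U i - lam z * Q i \<le> B i z))"

lemma split_val_zero:
  assumes "{} \<in> F" "\<And>i z. i < n \<Longrightarrow> G i z \<Longrightarrow> 0 \<le> B i z"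
  shows "split_val n F C G lam B 0"
  unfolding split_val_def
  by (rule exI[of _ "\<lambda>_. 0"], rule exI[of _ "\<lambda>_. 0"]) (use assms in \<open>force simp: hull_ineqs_def\<close>)

text \<open>All requirements are linear in the pair \<open>(U, Q)\<close> and survive averaging. As
  \<open>p\<close> may have infinite support, integrability of the chosen splits has to be
  established.\<close>

lemma split_val_average:
  assumes F: "F \<subseteq> Pow {..<n}" and "0 \<le> C"
    and sp: "\<And>d. d \<in> set_pmf p \<Longrightarrow> split_val n F C G lam (B d) (f d)"
    and f: "integrable (measure_pmf p) f"
    and B: "\<And>i z. i < n \<Longrightarrow> G i z \<Longrightarrow> integrable (measure_pmf p) (\<lambda>d. B d i z)"
  shows "split_val n F C G lam (\<lambda>i z. measure_pmf.expectation p (\<lambda>d. B d i z)) (measure_pmf.expectation p f)"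
proof -
  have "\<forall>d\<in>set_pmf p. \<exists>UQ. f d = (\<Sum>i<n. fst UQ i) \<and> hull_ineqs n F (snd UQ) \<and>
     (\<forall>i<n. fst UQ i \<le> C * snd UQ i) \<and> (\<forall>i<n. \<forall>z. G i z \<longrightarrow> fst UQ i - lam z * snd UQ i \<le> B d i z)"
    using sp unfolding split_val_def by simp
  from bchoice[OF this] obtain UQ where UQ: "\<forall>d\<in>set_pmf p. f d = (\<Sum>i<n. fst (UQ d) i) \<and>
     hull_ineqs n F (snd (UQ d)) \<and> (\<forall>i<n. fst (UQ d) i \<le> C * snd (UQ d) i) \<and>
     (\<forall>i<n. \<forall>z. G i z \<longrightarrow> fst (UQ d) i - lam z * snd (UQ d) i \<le> B d i z)" ..
  define U where "U = (\<lambda>d. fst (UQ d))"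
  define Q where "Q = (\<lambda>d. snd (UQ d))"
  have fU: "f d = (\<Sum>i<n. U d i)" and cQ: "hull_ineqs n F (Q d)"
    and UQ': "\<And>i. i < n \<Longrightarrow> U d i \<le> C * Q d i"
    and UB: "\<And>i z. i < n \<Longrightarrow> G i z \<Longrightarrow> U d i - lam z * Q d i \<le> B d i z"
    if "d \<in> set_pmf p" for d
    using bspec[OF UQ that] unfolding U_def Q_def by blast+
  have Q01: "0 \<le> Q d i" "Q d i \<le> 1" if "d \<in> set_pmf p" "i < n" for d i
    using hull_ineqs_nonneg[OF cQ[OF that(1)] F that(2)] hull_ineqs_le_1[OF cQ[OF that(1)] F that(2)] by blast+
  have UC: "U d i \<le> C" if "d \<in> set_pmf p" "i < n" for d i
    using UQ'[OF that] Q01[OF that] \<open>0 \<le> C\<close> mult_left_le[of "Q d i" C] by linarith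
  have intQ: "integrable (measure_pmf p) (\<lambda>d. Q d i)" if "i < n" for i
    by (rule measure_pmf.integrable_const_bound[where B = 1]) (use Q01 that in \<open>auto simp: AE_measure_pmf_iff\<close>)
  \<comment> \<open>From above \<open>U d i\<close> is bounded by \<open>C\<close>; from below it
    equals \<open>f d\<close> minus components that are at most \<open>C\<close> each.\<close>
  have intU: "integrable (measure_pmf p) (\<lambda>d. U d i)" if "i < n" for i
  proof (rule Bochner_Integration.integrable_bound[where f = "\<lambda>d. \<bar>f d\<bar> + real n * C"])
    show "integrable (measure_pmf p) (\<lambda>d. \<bar>f d\<bar> + real n * C)"
      using f by (intro Bochner_Integration.integrable_add integrable_abs) auto
    have "norm (U d i) \<le> norm (\<bar>f d\<bar> + real n * C)" if d: "d \<in> set_pmf p" for d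
    proof -
      have "f d = U d i + (\<Sum>j\<in>{..<n} - {i}. U d j)"
        using fU[OF d] \<open>i < n\<close> by (simp add: sum.remove[of "{..<n}" i])
      moreover have "(\<Sum>j\<in>{..<n} - {i}. U d j) \<le> (\<Sum>j\<in>{..<n} - {i}. C)"
        by (intro sum_mono UC[OF d]) auto
      moreover have "(\<Sum>j\<in>{..<n} - {i}. C) \<le> (\<Sum>j\<in>{..<n}. C)"
        using \<open>0 \<le> C\<close> by (intro sum_mono2) auto
      moreover have "C \<le> real n * C"
        using \<open>0 \<le> C\<close> \<open>i < n\<close> mult_right_mono[of 1 "real n" C] by auto
      ultimately show ?thesis using UC[OF d \<open>i < n\<close>] by (auto simp: abs_real_def)
    qed
    then show "AE d in measure_pmf p. norm (U d i) \<le> norm (\<bar>f d\<bar> + real n * C)"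
      by (auto simp: AE_measure_pmf_iff)
  qed auto
  let ?E = "measure_pmf.expectation p"
  show ?thesis
    unfolding split_val_def
  proof (rule exI[of _ "\<lambda>i. ?E (\<lambda>d. U d i)"], rule exI[of _ "\<lambda>i. ?E (\<lambda>d. Q d i)"], intro conjI allI impI)
    have "?E f = ?E (\<lambda>d. \<Sum>i<n. U d i)" by (rule pmf_expectation_cong) (rule fU)
    also have "\<dots> = (\<Sum>i<n. ?E (\<lambda>d. U d i))" by (rule Bochner_Integration.integral_sum) (simp add: intU)
    finally show "?E f = (\<Sum>i<n. ?E (\<lambda>d. U d i))" .
  next
    show "hull_ineqs n F (\<lambda>i. ?E (\<lambda>d. Q d i))"
      unfolding hull_ineqs_def
    proof (intro allI impI)
      fix a b assume ab: "\<forall>D\<in>F. (\<Sum>i\<in>D. a i) \<le> (b::real)"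
      have "(\<Sum>i<n. a i * ?E (\<lambda>d. Q d i)) = ?E (\<lambda>d. \<Sum>i<n. a i * Q d i)"
        by (subst Bochner_Integration.integral_sum) (simp_all add: intQ)
      also have "\<dots> \<le> b"
      proof (rule measure_pmf.integral_le_const)
        show "AE d in measure_pmf p. (\<Sum>i<n. a i * Q d i) \<le> b"
          using cQ ab unfolding AE_measure_pmf_iff hull_ineqs_def by blast
      qed (use intQ in auto)
      finally show "(\<Sum>i<n. a i * ?E (\<lambda>d. Q d i)) \<le> b" .
    qed
  next
    fix i assume i: "i < n"
    have "?E (\<lambda>d. U d i) \<le> ?E (\<lambda>d. C * Q d i)"
      by (rule integral_mono_AE) (simp_all add: intU intQ i UQ' AE_measure_pmf_iff)
    then show "?E (\<lambda>d. U d i) \<le> C * ?E (\<lambda>d. Q d i)" by simp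
  next
    fix i z assume i: "i < n" "G i z"
    have "?E (\<lambda>d. U d i - lam z * Q d i) \<le> ?E (\<lambda>d. B d i z)"
      by (rule integral_mono_AE) (simp_all add: intU intQ i UB B AE_measure_pmf_iff)
    then show "?E (\<lambda>d. U d i) - lam z * ?E (\<lambda>d. Q d i) \<le> ?E (\<lambda>d. B d i z)"
      using intU intQ i by simp
  qed
qed

text \<open>\<open>V\<close> is a supersolution, with slack \<open>e\<close> per step, of the
  optimality equation of a single MDP in which selection costs \<open>lam\<close> and quitting with
  value 0 is always allowed. The slack accommodates infinite action sets, where a best action may
  not exist.\<close>

definition priced_super :: "('s, 'a) mdp \<Rightarrow> real \<Rightarrow> real \<Rightarrow> ('s \<Rightarrow> real) \<Rightarrow> bool" where
  "priced_super M lam e V \<longleftrightarrow> (\<forall>s\<in>mstates M. 0 \<le> V s \<and>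
     (s \<in> mterm M \<longrightarrow> mval M s - lam \<le> V s) \<and>
     (s \<notin> mterm M \<longrightarrow> (\<forall>a\<in>macts M s.
        - mcost M a + measure_pmf.expectation (mtrans M s a) V \<le> V s + e)))"

lemma wf_mdp_trans:
  assumes "wf_mdp M" "s \<in> mstates M" "a \<in> macts M s"
  shows "s \<notin> mterm M" "0 \<le> mcost M a" "set_pmf (mtrans M s a) \<subseteq> mstates M"
    "finite (set_pmf (mtrans M s a))"
proof -
  show s: "s \<notin> mterm M" using assms by (auto simp: wf_mdp_def)
  then show "0 \<le> mcost M a" and sub: "set_pmf (mtrans M s a) \<subseteq> mstates M"
    using assms by (auto simp: wf_mdp_def)
  show "finite (set_pmf (mtrans M s a))" using finite_subset[OF sub] assms(1) by (auto simp: wf_mdp_def)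
qed

text \<open>A decision distribution for which the utility is not integrable has expectation 0, so it
  behaves like halting with the empty set.\<close>

lemma policy_split:
  fixes M :: "nat \<Rightarrow> ('s, 'a) mdp"
  assumes inst: "cics_instance n F M" and "0 \<le> C"
    and C: "\<And>i t. i < n \<Longrightarrow> t \<in> mterm (M i) \<Longrightarrow> mval (M i) t \<le> C"
    and "\<And>i. i < n \<Longrightarrow> x i \<in> mstates (M i)"
  shows "split_val n F C (\<lambda>i (lam, e, V). 0 \<le> e \<and> priced_super (M i) lam e V) fst
           (\<lambda>i (lam, e, V). V (x i) + real k * e) (util_fuel k n F M P h x)"
  using assms(4)
proof (induction k arbitrary: h x)
  case 0
  have "{} \<in> F" using inst by (auto simp: cics_instance_def downward_closed_def)
  then have "split_val n F C (\<lambda>i (lam, e, V). 0 \<le> e \<and> priced_super (M i) lam e V) fst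
           (\<lambda>i (lam, e, V). V (x i) + real 0 * e) 0"
    by (rule split_val_zero) (use 0 in \<open>auto simp: priced_super_def\<close>)
  then show ?case by simp
next
  case (Suc k)
  let ?G = "\<lambda>i (lam, e, V). 0 \<le> e \<and> priced_super (M i) lam e (V :: 's \<Rightarrow> real)"
  let ?B = "\<lambda>i (lam :: real, e, V :: 's \<Rightarrow> real). V (x i) + real (Suc k) * e"
  have F: "F \<subseteq> Pow {..<n}" "{} \<in> F"
    using inst by (auto simp: cics_instance_def downward_closed_def)
  have wf: "wf_mdp (M i)" if "i < n" for i using inst that by (auto simp: cics_instance_def)
  have zero: "split_val n F C ?G fst ?B 0"
    using F(2) by (rule split_val_zero) (use Suc.prems in \<open>auto simp: priced_super_def\<close>)
  define f where "f = (\<lambda>d. case d of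
        Halt S \<Rightarrow> (if legal_halt F M x S then (\<Sum>i\<in>S. mval (M i) (x i)) else 0)
      | Adv i a \<Rightarrow> (if legal_adv n M x i a then
            - mcost (M i) a + measure_pmf.expectation (mtrans (M i) (x i) a)
                 (\<lambda>s'. util_fuel k n F M P (h @ [(d, x(i := s'))]) (x(i := s')))
          else 0))"
  have step: "split_val n F C ?G fst ?B (f d)" for d
  proof (cases d)
    case (Halt S)
    show ?thesis
    proof (cases "legal_halt F M x S")
      case False
      then show ?thesis using zero by (simp add: f_def Halt)
    next
      case True
      then have S: "S \<in> F" "\<And>i. i \<in> S \<Longrightarrow> x i \<in> mterm (M i)" by (auto simp: legal_halt_def)
      have Sn: "{..<n} \<inter> S = S" using S F by auto
      have restr: "(\<Sum>i<n. if i \<in> S then g i else 0) = (\<Sum>i\<in>S. g i)" for g :: "nat \<Rightarrow> real"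
        using sum.inter_restrict[of "{..<n}" g S] Sn by simp
      show ?thesis
        unfolding split_val_def
      \<comment> \<open>On halting, \<open>Q\<close> is the indicator vector of \<open>S\<close>, a
        vertex of the hull.\<close>
      proof (rule exI[of _ "\<lambda>i. if i \<in> S then mval (M i) (x i) else 0"],
          rule exI[of _ "\<lambda>i. if i \<in> S then 1 else 0"], intro conjI allI impI)
        show "f d = (\<Sum>i<n. if i \<in> S then mval (M i) (x i) else 0)"
          using True by (simp add: f_def Halt restr)
        show "hull_ineqs n F (\<lambda>i. if i \<in> S then 1 else 0)"
          using S restr by (auto simp: hull_ineqs_def if_distrib cong: if_cong)
        show "(if i \<in> S then mval (M i) (x i) else 0) \<le> C * (if i \<in> S then 1 else 0)" if "i < n" for i
          using C that S by auto
        show "(if i \<in> S then mval (M i) (x i) else 0) - fst z * (if i \<in> S then 1 else 0) \<le> ?B i z"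
          if "i < n" "?G i z" for i z
        proof -
          obtain lam e V where z: "z = (lam, e, V)" by (cases z) auto
          have "0 \<le> e" "priced_super (M i) lam e V" using that by (auto simp: z)
          then have "0 \<le> V (x i)" "x i \<in> mterm (M i) \<Longrightarrow> mval (M i) (x i) - lam \<le> V (x i)"
            using Suc.prems[OF \<open>i < n\<close>] unfolding priced_super_def by blast+
          moreover have "0 \<le> real (Suc k) * e" using \<open>0 \<le> e\<close> by simp
          ultimately have "(if i \<in> S then mval (M i) (x i) - lam else 0) \<le> V (x i) + real (Suc k) * e"
            using S(2)[of i] by (auto simp del: of_nat_Suc)
          then show ?thesis by (auto simp: z)
        qed
      qed
    qed
  next
    case (Adv j a)
    show ?thesis
    proof (cases "legal_adv n M x j a")
      case False
      then show ?thesis using zero by (simp add: f_def Adv)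
    next
      case True
      then have j: "j < n" "a \<in> macts (M j) (x j)" by (auto simp: legal_adv_def)
      note tr = wf_mdp_trans[OF wf[OF j(1)] Suc.prems[OF j(1)] j(2)]
      let ?p = "mtrans (M j) (x j) a"
      let ?u = "\<lambda>s'. util_fuel k n F M P (h @ [(d, x(j := s'))]) (x(j := s'))"
      have int: "integrable (measure_pmf ?p) g" for g :: "'s \<Rightarrow> real"
        using tr(4) by (rule integrable_measure_pmf_finite)
      have "split_val n F C ?G fst
        (\<lambda>i z. measure_pmf.expectation ?p (\<lambda>s'. (\<lambda>i (lam, e, V). V ((x(j := s')) i) + real k * e) i z))
        (measure_pmf.expectation ?p ?u)"
      proof (rule split_val_average[OF F(1) \<open>0 \<le> C\<close>])
        fix s' assume "s' \<in> set_pmf ?p"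
        then show "split_val n F C ?G fst (\<lambda>i (lam, e, V). V ((x(j := s')) i) + real k * e) (?u s')"
          using tr Suc.prems by (intro Suc.IH) auto
      qed (rule int)+
      then obtain U Q where E: "measure_pmf.expectation ?p ?u = (\<Sum>i<n. U i)" and cQ: "hull_ineqs n F Q"
        and UC: "\<And>i. i < n \<Longrightarrow> U i \<le> C * Q i"
        and UB: "\<And>i z. i < n \<Longrightarrow> ?G i z \<Longrightarrow> U i - fst z * Q i \<le>
            measure_pmf.expectation ?p (\<lambda>s'. (\<lambda>i (lam, e, V). V ((x(j := s')) i) + real k * e) i z)"
        unfolding split_val_def by auto
      show ?thesis
        unfolding split_val_def
      \<comment> \<open>The cost is charged to the MDP that advances; \<open>Q\<close> comes from
        averaging over the successors.\<close>
      proof (rule exI[of _ "\<lambda>i. U i - (if i = j then mcost (M j) a else 0)"], rule exI[of _ Q],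
          intro conjI allI impI)
        show "f d = (\<Sum>i<n. U i - (if i = j then mcost (M j) a else 0))"
          using True E j by (simp add: f_def Adv sum_subtractf)
        show "hull_ineqs n F Q" by (rule cQ)
        show "U i - (if i = j then mcost (M j) a else 0) \<le> C * Q i" if "i < n" for i
          using UC[OF that] tr(2) by auto
        show "U i - (if i = j then mcost (M j) a else 0) - fst z * Q i \<le> ?B i z"
          if "i < n" "?G i z" for i z
        proof -
          obtain lam e V where z: "z = (lam, e, V)" by (cases z) auto
          have ps: "0 \<le> e" "priced_super (M i) lam e V" using that by (auto simp: z)
          have *: "U i - lam * Q i \<le> measure_pmf.expectation ?p (\<lambda>s'. V ((x(j := s')) i)) + real k * e"
            using UB[OF that] by (simp add: z int)
          show ?thesis
          \<comment> \<open>The advanced MDP spends one \<open>e\<close> on its optimality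
            inequality; for all others the state, and with it \<open>V\<close>, is
            unchanged.\<close>
          proof (cases "i = j")
            case True
            have "- mcost (M j) a + measure_pmf.expectation ?p V \<le> V (x j) + e"
              using ps j Suc.prems[OF j(1)] tr(1) unfolding True priced_super_def by auto
            then show ?thesis using * by (simp add: z True algebra_simps)
          next
            case False
            then show ?thesis using * ps(1) by (simp add: z algebra_simps)
          qed
        qed
      qed
    qed
  qed
  have util: "util_fuel (Suc k) n F M P h x = measure_pmf.expectation (P h x) f"
    by (simp add: f_def)
  show ?case
  proof (cases "integrable (measure_pmf (P h x)) f")
    case False
    then show ?thesis using zero unfolding util by (simp add: not_integrable_integral_eq)
  next
    case True
    have "split_val n F C ?G fst (\<lambda>i z. measure_pmf.expectation (P h x) (\<lambda>d. ?B i z))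
       (measure_pmf.expectation (P h x) f)"
      by (rule split_val_average[OF F(1) \<open>0 \<le> C\<close> step True]) auto
    then show ?thesis unfolding util by simp
  qed
qed

section \<open>Markov strategies and committing policies\<close>

text \<open>\<open>go s\<close> means continuing, or being selected at a sink; \<open>q s\<close>
  and \<open>u s\<close> are the selection probability and the expected utility from
  \<open>s\<close> on, pinned down by one-step equations instead of a recursion.
  \<open>act s\<close> is available even where \<open>go s\<close> fails, so that \<open>act\<close>
  yields a commitment.\<close>

definition strategy ::
  "('s, 'a) mdp \<Rightarrow> ('s \<Rightarrow> bool) \<Rightarrow> ('s \<Rightarrow> 'a) \<Rightarrow> ('s \<Rightarrow> real) \<Rightarrow> ('s \<Rightarrow> real) \<Rightarrow> bool" where
  "strategy M go act q u \<longleftrightarrow> (\<forall>s\<in>mstates M. 0 \<le> q s \<and> q s \<le> 1 \<and> (\<not> go s \<longrightarrow> q s = 0 \<and> u s = 0) \<and>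
     (s \<in> mterm M \<and> go s \<longrightarrow> q s = 1 \<and> u s = mval M s) \<and>
     (s \<notin> mterm M \<longrightarrow> act s \<in> macts M s \<and> (go s \<longrightarrow>
        q s = measure_pmf.expectation (mtrans M s (act s)) q \<and>
        u s = - mcost M (act s) + measure_pmf.expectation (mtrans M s (act s)) u)))"

lemma mdp_edges_subset: "wf_mdp M \<Longrightarrow> mdp_edges M \<subseteq> mstates M \<times> mstates M"
  using wf_mdp_trans(3)[of M] by (fastforce simp: mdp_edges_def)

lemma wf_mdp_edges: "wf_mdp M \<Longrightarrow> wf ((mdp_edges M)\<inverse>)"
  using finite_subset[OF mdp_edges_subset[of M]] by (intro finite_acyclic_wf_converse) (auto simp: wf_mdp_def)

text \<open>Backward induction over the acyclic state graph: take an action within \<open>e\<close>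
  of the supremum, and stop if its value is negative. Then \<open>u - lam * q\<close> is nonnegative
  and optimal up to the slack.\<close>

lemma priced_strategy_exists:
  fixes M :: "('s, 'a) mdp"
  assumes M: "wf_mdp M" and "0 < e"
  shows "\<exists>go act q u. strategy M go act q u \<and> priced_super M lam e (\<lambda>s. u s - lam * q s)"
proof -
  let ?E = "\<lambda>s a g. measure_pmf.expectation (mtrans M s a) g"
  \<comment> \<open>\<open>P f s r\<close> says that the record \<open>r\<close> of continuation
    flag, action, \<open>q\<close> and \<open>u\<close> is right at \<open>s\<close> when
    \<open>f\<close> is followed at the successors. Well-founded choice glues the local
    records.\<close>
  define P :: "('s \<Rightarrow> bool \<times> 'a \<times> real \<times> real) \<Rightarrow> 's \<Rightarrow> bool \<times> 'a \<times> real \<times> real \<Rightarrow> bool" where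
    "P = (\<lambda>f s (g, a, q, u). s \<in> mstates M \<longrightarrow> 0 \<le> q \<and> q \<le> 1 \<and> (\<not> g \<longrightarrow> q = 0 \<and> u = 0) \<and>
       0 \<le> u - lam * q \<and>
       (s \<in> mterm M \<longrightarrow> (g \<longrightarrow> q = 1 \<and> u = mval M s) \<and> mval M s - lam \<le> u - lam * q) \<and>
       (s \<notin> mterm M \<longrightarrow> a \<in> macts M s \<and>
          (g \<longrightarrow> q = ?E s a (\<lambda>t. fst (snd (snd (f t)))) \<and>
             u = - mcost M a + ?E s a (\<lambda>t. snd (snd (snd (f t))))) \<and>
          (\<forall>b\<in>macts M s. - mcost M b + ?E s b (\<lambda>t. snd (snd (snd (f t))) - lam * fst (snd (snd (f t))))
             \<le> u - lam * q + e)))"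
  have "\<exists>f. \<forall>s. P f s (f s)"
  proof (rule dependent_wf_choice[OF wf_mdp_edges[OF M]])
    fix f g :: "'s \<Rightarrow> bool \<times> 'a \<times> real \<times> real" and s r
    assume fg: "\<And>z. (z, s) \<in> (mdp_edges M)\<inverse> \<Longrightarrow> f z = g z"
    have eqs: "?E s b (\<lambda>t. h (f t)) = ?E s b (\<lambda>t. h (g t))" if "s \<in> mstates M" "b \<in> macts M s"
      for b and h :: "bool \<times> 'a \<times> real \<times> real \<Rightarrow> real"
      using that by (intro pmf_expectation_cong arg_cong[of _ _ h] fg) (auto simp: mdp_edges_def)
    note eq = eqs[of _ "\<lambda>r. fst (snd (snd r))"] eqs[of _ "\<lambda>r. snd (snd (snd r))"]
      eqs[of _ "\<lambda>r. snd (snd (snd r)) - lam * fst (snd (snd r))"]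
    show "P f s r = P g s r"
      by (cases r) (use eq in \<open>auto simp: P_def\<close>)
  next
    fix s and f :: "'s \<Rightarrow> bool \<times> 'a \<times> real \<times> real"
    assume IH: "\<And>t. (t, s) \<in> (mdp_edges M)\<inverse> \<Longrightarrow> P f t (f t)"
    define qf where "qf = (\<lambda>t. fst (snd (snd (f t))))"
    define uf where "uf = (\<lambda>t. snd (snd (snd (f t))))"
    have fq: "fst (snd (snd (f t))) = qf t" and fu: "snd (snd (snd (f t))) = uf t" for t
      by (simp_all add: qf_def uf_def)
    show "\<exists>r. P f s r"
    proof (cases "s \<in> mstates M")
      case False
      then show ?thesis by (intro exI[of _ "(False, undefined, 0, 0)"]) (auto simp: P_def)
    next
      case s: True
      show ?thesis
      proof (cases "s \<in> mterm M")
        case True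
        show ?thesis
        proof (cases "0 \<le> mval M s - lam")
          case True
          then show ?thesis using \<open>s \<in> mterm M\<close>
            by (intro exI[of _ "(True, undefined, 1, mval M s)"]) (auto simp: P_def)
        next
          case False
          then show ?thesis using \<open>s \<in> mterm M\<close>
            by (intro exI[of _ "(False, undefined, 0, 0)"]) (auto simp: P_def)
        qed
      next
        case nt: False
        define W where "W = (\<lambda>a. - mcost M a + ?E s a (\<lambda>t. uf t - lam * qf t))"
        have int: "integrable (measure_pmf (mtrans M s a)) g" if "a \<in> macts M s" for a and g :: "'s \<Rightarrow> real"
          using wf_mdp_trans(4)[OF M s that] by (rule integrable_measure_pmf_finite)
        have fin: "finite (mstates M)" and ne: "macts M s \<noteq> {}" using M s nt by (auto simp: wf_mdp_def)
        have "W a \<le> (\<Sum>t\<in>mstates M. \<bar>uf t - lam * qf t\<bar>)" if a: "a \<in> macts M s" for a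
        proof -
          have "?E s a (\<lambda>t. uf t - lam * qf t) \<le> (\<Sum>t\<in>mstates M. \<bar>uf t - lam * qf t\<bar>)"
          proof (rule measure_pmf.integral_le_const[OF int[OF a]])
            have "uf t - lam * qf t \<le> (\<Sum>t\<in>mstates M. \<bar>uf t - lam * qf t\<bar>)" if "t \<in> mstates M" for t
              using member_le_sum[OF that, of "\<lambda>t. \<bar>uf t - lam * qf t\<bar>"] fin by auto
            then show "AE t in measure_pmf (mtrans M s a). uf t - lam * qf t \<le> (\<Sum>t\<in>mstates M. \<bar>uf t - lam * qf t\<bar>)"
              using wf_mdp_trans(3)[OF M s a] by (auto simp: AE_measure_pmf_iff)
          qed
          then show ?thesis using wf_mdp_trans(2)[OF M s a] by (simp add: W_def)
        qed
        then have bdd: "bdd_above (W ` macts M s)" by (rule bdd_aboveI2)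
        obtain a where a: "a \<in> macts M s" "Sup (W ` macts M s) - e < W a"
          using less_cSup_iff[of "W ` macts M s" "Sup (W ` macts M s) - e"] bdd ne \<open>0 < e\<close> by auto
        have Wb: "W b \<le> W a + e" if "b \<in> macts M s" for b
          using cSup_upper[OF _ bdd, of "W b"] that a(2) by auto
        show ?thesis
        proof (cases "0 \<le> W a")
          case False
          then have "W b \<le> e" if "b \<in> macts M s" for b using Wb[OF that] by auto
          then show ?thesis using nt a(1)
            by (intro exI[of _ "(False, a, 0, 0)"]) (auto simp: P_def W_def uf_def qf_def)
        next
          case True
          have q01: "0 \<le> qf t \<and> qf t \<le> 1" if "t \<in> set_pmf (mtrans M s a)" for t
            using IH[of t] that wf_mdp_trans(3)[OF M s a(1)] a(1) s
            by (cases "f t") (auto simp: P_def mdp_edges_def qf_def)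
          have "0 \<le> ?E s a qf"
            by (rule integral_nonneg_AE) (use q01 in \<open>auto simp: AE_measure_pmf_iff\<close>)
          moreover have "?E s a qf \<le> 1"
            by (rule measure_pmf.integral_le_const[OF int[OF a(1)]]) (use q01 in \<open>auto simp: AE_measure_pmf_iff\<close>)
          moreover have Wa: "W a = (- mcost M a + ?E s a uf) - lam * ?E s a qf"
            using int[OF a(1)] by (simp add: W_def)
          moreover have "\<forall>b\<in>macts M s. - mcost M b + ?E s b (\<lambda>t. uf t - lam * qf t)
              \<le> (- mcost M a + ?E s a uf) - lam * ?E s a qf + e"
          proof
            fix b assume "b \<in> macts M s"
            then have "W b \<le> W a + e" by (rule Wb)
            also have "W b = - mcost M b + ?E s b (\<lambda>t. uf t - lam * qf t)" by (simp add: W_def)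
            finally show "- mcost M b + ?E s b (\<lambda>t. uf t - lam * qf t)
              \<le> (- mcost M a + ?E s a uf) - lam * ?E s a qf + e" unfolding Wa .
          qed
          ultimately have "P f s (True, a, ?E s a qf, - mcost M a + ?E s a uf)"
            using nt a(1) True unfolding Wa P_def prod.case fq fu by blast
          then show ?thesis by blast
        qed
      qed
    qed
  qed
  then obtain f where f: "\<And>s. P f s (f s)" by blast
  let ?q = "\<lambda>s. fst (snd (snd (f s)))" and ?u = "\<lambda>s. snd (snd (snd (f s)))"
  show ?thesis
  proof (intro exI conjI)
    show "strategy M (\<lambda>s. fst (f s)) (\<lambda>s. fst (snd (f s))) ?q ?u"
      unfolding strategy_def using f by (auto simp: P_def case_prod_beta)
    show "priced_super M lam e (\<lambda>s. ?u s - lam * ?q s)"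
      unfolding priced_super_def using f by (auto simp: P_def case_prod_beta)
  qed
qed

section \<open>The committing plan and its value\<close>

text \<open>Memoryless: the past is recovered from the current states by replaying the list. A
  feasible item counts as selected at a sink with \<open>go\<close>, and as given up without
  \<open>go\<close>; the first one in neither case is advanced.\<close>

fun plan :: "nat set set \<Rightarrow> (nat \<Rightarrow> ('s, 'a) mdp) \<Rightarrow> (nat \<Rightarrow> 's \<Rightarrow> bool) \<Rightarrow> nat list \<Rightarrow> nat set
    \<Rightarrow> (nat \<Rightarrow> 's) \<Rightarrow> cdecision" where
  "plan F M go [] S x = CHalt S"
| "plan F M go (i # l) S x =
     (if insert i S \<in> F \<and> go i (x i) then
        (if x i \<in> mterm (M i) then plan F M go l (insert i S) x else CAdv i)
      else plan F M go l S x)"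

text \<open>When the plan halts, every feasible item it passed has \<open>q\<close> equal to 0 or 1
  at its current state, so the greedy value is no longer random.\<close>

lemma plan_halt:
  assumes "plan F M go l S x = CHalt T" "S \<in> F" "\<forall>i\<in>S. x i \<in> mterm (M i)" "finite S"
    "distinct l" "S \<inter> set l = {}"
    and "\<And>i. i \<in> set l \<Longrightarrow> strategy (M i) (go i) (act i) (q i) (u i) \<and> x i \<in> mstates (M i)"
  shows "T \<in> F \<and> (\<forall>i\<in>T. x i \<in> mterm (M i)) \<and>
     (\<Sum>i\<in>T. mval (M i) (x i)) = (\<Sum>i\<in>S. mval (M i) (x i)) +
       greedy_val F (\<lambda>i. q i (x i)) (\<lambda>i. u i (x i)) l S"
  using assms
proof (induction l arbitrary: S)
  case Nil
  then show ?case by auto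
next
  case (Cons i l)
  have i: "strategy (M i) (go i) (act i) (q i) (u i)" "x i \<in> mstates (M i)" using Cons.prems by auto
  have no: "i \<notin> S" "i \<notin> set l" using Cons.prems by auto
  show ?case
  proof (cases "insert i S \<in> F \<and> go i (x i)")
    case True
    then have t: "x i \<in> mterm (M i)" using Cons.prems(1) by (auto split: if_splits)
    then have "q i (x i) = 1" "u i (x i) = mval (M i) (x i)" using i True by (auto simp: strategy_def)
    then show ?thesis
      using Cons.IH[of "insert i S"] Cons.prems True t no by simp
  next
    case False
    have "insert i S \<in> F \<Longrightarrow> q i (x i) = 0 \<and> u i (x i) = 0" using i False by (auto simp: strategy_def)
    then show ?thesis
      using Cons.IH[of S] Cons.prems False by auto
  qed
qed

lemma plan_adv:
  assumes "plan F M go l S x = CAdv i" "distinct l"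
    and "\<And>i. i \<in> set l \<Longrightarrow> strategy (M i) (go i) (act i) (q i) (u i) \<and> x i \<in> mstates (M i)"
  shows "i \<in> set l \<and> x i \<notin> mterm (M i) \<and> go i (x i)"
  using assms by (induction l arbitrary: S) (auto split: if_splits)

text \<open>The items before \<open>i\<close> are settled, so the run reaches \<open>i\<close> with
  certainty, and \<open>i\<close> occurs once. The value is thus affine in the pair at
  \<open>i\<close>, and the one-step equations of that pair carry over.\<close>

lemma plan_adv_val:
  assumes "plan F M go l S x = CAdv i" "distinct l"
    and "\<And>i. i \<in> set l \<Longrightarrow> strategy (M i) (go i) (act i) (q i) (u i) \<and> x i \<in> mstates (M i)"
    and fin: "finite (set_pmf p)"
    and p: "q i (x i) = measure_pmf.expectation p (q i)" "u i (x i) = - c + measure_pmf.expectation p (u i)"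
  shows "greedy_val F (\<lambda>j. q j (x j)) (\<lambda>j. u j (x j)) l S = - c + measure_pmf.expectation p
     (\<lambda>s'. greedy_val F (\<lambda>j. q j ((x(i := s')) j)) (\<lambda>j. u j ((x(i := s')) j)) l S)"
  using assms(1-3)
proof (induction l arbitrary: S)
  case Nil
  then show ?case by simp
next
  case (Cons j l)
  have int: "integrable (measure_pmf p) g" for g :: "_ \<Rightarrow> real"
    using fin by (rule integrable_measure_pmf_finite)
  have j: "strategy (M j) (go j) (act j) (q j) (u j)" "x j \<in> mstates (M j)" using Cons.prems by auto
  have unroll: "greedy_val F (\<lambda>j. q j (x j)) (\<lambda>j. u j (x j)) l S' = - c + measure_pmf.expectation p
     (\<lambda>s'. greedy_val F (\<lambda>j. q j ((x(i := s')) j)) (\<lambda>j. u j ((x(i := s')) j)) l S')"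
    if "plan F M go l S' x = CAdv i" for S'
    using that Cons.prems by (intro Cons.IH) auto
  show ?case
  proof (cases "insert j S \<in> F \<and> go j (x j)")
    case True
    show ?thesis
    proof (cases "x j \<in> mterm (M j)")
      case t: True
      then have "q j (x j) = 1" "u j (x j) = mval (M j) (x j)" using j True by (auto simp: strategy_def)
      moreover have "plan F M go l (insert j S) x = CAdv i" using Cons.prems True t by simp
      moreover from this have "j \<noteq> i" using plan_adv[of F M go l "insert j S" x i] Cons.prems by auto
      ultimately show ?thesis using True unroll[of "insert j S"] int by simp
    next
      case False
      then have [simp]: "j = i" using Cons.prems True by simp
      have "i \<notin> set l" using Cons.prems by auto
      then have eq: "greedy_val F (\<lambda>j. q j ((x(i := s')) j)) (\<lambda>j. u j ((x(i := s')) j)) l T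
          = greedy_val F (\<lambda>j. q j (x j)) (\<lambda>j. u j (x j)) l T" for s' T
        by (intro greedy_val_cong) auto
      show ?thesis using True p int by (simp add: eq del: fun_upd_apply add: fun_upd_same)
    qed
  next
    case False
    have z: "insert j S \<in> F \<Longrightarrow> q j (x j) = 0 \<and> u j (x j) = 0" using j False by (auto simp: strategy_def)
    have pl: "plan F M go l S x = CAdv i" using Cons.prems False by auto
    then have "j \<noteq> i" using plan_adv[of F M go l S x i] Cons.prems by auto
    then show ?thesis using z unroll[OF pl] by auto
  qed
qed

text \<open>Counts the states reachable in at least one step: a potential that falls strictly along
  edges and so bounds the number of remaining moves.\<close>

definition mdp_height :: "('s, 'a) mdp \<Rightarrow> 's \<Rightarrow> nat" where
  "mdp_height M s = card {t. (s, t) \<in> (mdp_edges M)\<^sup>+}"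

lemma mdp_height_finite:
  assumes "wf_mdp M"
  shows "finite {t. (s, t) \<in> (mdp_edges M)\<^sup>+}" "mdp_height M s \<le> card (mstates M)"
proof -
  have sub: "{t. (s, t) \<in> (mdp_edges M)\<^sup>+} \<subseteq> mstates M"
    using trancl_subset_Sigma[OF mdp_edges_subset[OF assms]] by auto
  have fin: "finite (mstates M)" using assms by (auto simp: wf_mdp_def)
  show "finite {t. (s, t) \<in> (mdp_edges M)\<^sup>+}" using sub fin by (rule finite_subset)
  show "mdp_height M s \<le> card (mstates M)" unfolding mdp_height_def using fin sub by (rule card_mono)
qed

lemma mdp_height_less:
  assumes "wf_mdp M" "(s, t) \<in> mdp_edges M"
  shows "mdp_height M t < mdp_height M s"
  unfolding mdp_height_def
proof (rule psubset_card_mono)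
  have "(t, t) \<notin> (mdp_edges M)\<^sup>+" using assms(1) by (auto simp: wf_mdp_def acyclic_def)
  then show "{r. (t, r) \<in> (mdp_edges M)\<^sup>+} \<subset> {r. (s, r) \<in> (mdp_edges M)\<^sup>+}"
    using assms(2) by (auto intro: trancl_into_trancl2)
qed (rule mdp_height_finite[OF assms(1)])

definition plan_policy :: "nat set set \<Rightarrow> (nat \<Rightarrow> ('s, 'a) mdp) \<Rightarrow> (nat \<Rightarrow> 's \<Rightarrow> bool) \<Rightarrow> (nat \<Rightarrow> 's \<Rightarrow> 'a)
    \<Rightarrow> nat list \<Rightarrow> ('s, 'a) policy" where
  "plan_policy F M go act l = (\<lambda>h x. return_pmf (case plan F M go l {} x of
       CHalt S \<Rightarrow> Halt S | CAdv i \<Rightarrow> Adv i (act i (x i))))"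

lemma committing_plan_policy: "committing (\<lambda>i s. return_pmf (act i s)) (plan_policy F M go act l)"
  unfolding committing_def
  by (rule exI[of _ "\<lambda>h x. return_pmf (plan F M go l {} x)"])
    (auto simp: plan_policy_def bind_return_pmf split: cdecision.splits)

text \<open>The total height drops with every move, so the fuel cannot run out first. The strict
  inequality reserves one unit for the final halt.\<close>

lemma util_fuel_plan_policy:
  assumes inst: "cics_instance n F M" and l: "distinct l" "set l \<subseteq> {..<n}"
    and str: "\<And>i. i < n \<Longrightarrow> strategy (M i) (go i) (act i) (q i) (u i)"
    and "\<And>i. i < n \<Longrightarrow> x i \<in> mstates (M i)"
    and "(\<Sum>i<n. mdp_height (M i) (x i)) < k"
  shows "util_fuel k n F M (plan_policy F M go act l) h x
           = greedy_val F (\<lambda>i. q i (x i)) (\<lambda>i. u i (x i)) l {}"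
  using assms(5,6)
proof (induction k arbitrary: h x)
  case 0
  then show ?case by simp
next
  case (Suc k)
  have "{} \<in> F" using inst by (auto simp: cics_instance_def downward_closed_def)
  have wf: "wf_mdp (M i)" if "i < n" for i using inst that by (auto simp: cics_instance_def)
  have sx: "strategy (M i) (go i) (act i) (q i) (u i) \<and> x i \<in> mstates (M i)" if "i \<in> set l" for i
    using that l str Suc.prems by auto
  show ?case
  proof (cases "plan F M go l {} x")
    case (CHalt T)
    have "T \<in> F \<and> (\<forall>i\<in>T. x i \<in> mterm (M i)) \<and>
     (\<Sum>i\<in>T. mval (M i) (x i)) = (\<Sum>i\<in>{}. mval (M i) (x i)) +
       greedy_val F (\<lambda>i. q i (x i)) (\<lambda>i. u i (x i)) l {}"
      by (rule plan_halt[OF CHalt \<open>{} \<in> F\<close> _ _ l(1) _ sx]) auto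
    then show ?thesis by (simp add: plan_policy_def CHalt legal_halt_def)
  next
    case (CAdv i)
    have i: "i \<in> set l" "x i \<notin> mterm (M i)" "go i (x i)" using plan_adv[OF CAdv l(1) sx] by auto
    then have "i < n" using l by auto
    note si = sx[OF i(1)]
    have a: "act i (x i) \<in> macts (M i) (x i)" using si i by (auto simp: strategy_def)
    note tr = wf_mdp_trans[OF wf[OF \<open>i < n\<close>] conjunct2[OF si] a]
    let ?p = "mtrans (M i) (x i) (act i (x i))"
    have IH: "util_fuel k n F M (plan_policy F M go act l) h' (x(i := s'))
       = greedy_val F (\<lambda>j. q j ((x(i := s')) j)) (\<lambda>j. u j ((x(i := s')) j)) l {}"
      if s': "s' \<in> set_pmf ?p" for h' s'
    proof (rule Suc.IH)
      show "(x(i := s')) j \<in> mstates (M j)" if "j < n" for j using that Suc.prems s' tr by auto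
      have "(\<Sum>j<n. mdp_height (M j) ((x(i := s')) j)) < (\<Sum>j<n. mdp_height (M j) (x j))"
      proof (rule sum_strict_mono_ex1)
        have "(x i, s') \<in> mdp_edges (M i)" using si a s' by (auto simp: mdp_edges_def)
        then have less: "mdp_height (M i) s' < mdp_height (M i) (x i)"
          by (rule mdp_height_less[OF wf[OF \<open>i < n\<close>]])
        then show "\<forall>j\<in>{..<n}. mdp_height (M j) ((x(i := s')) j) \<le> mdp_height (M j) (x j)" by auto
        show "\<exists>j\<in>{..<n}. mdp_height (M j) ((x(i := s')) j) < mdp_height (M j) (x j)"
          using less \<open>i < n\<close> by (intro bexI[of _ i]) auto
      qed auto
      then show "(\<Sum>j<n. mdp_height (M j) ((x(i := s')) j)) < k" using Suc.prems(2) by linarith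
    qed
    have "greedy_val F (\<lambda>j. q j (x j)) (\<lambda>j. u j (x j)) l {} = - mcost (M i) (act i (x i)) + measure_pmf.expectation ?p
     (\<lambda>s'. greedy_val F (\<lambda>j. q j ((x(i := s')) j)) (\<lambda>j. u j ((x(i := s')) j)) l {})"
    proof (rule plan_adv_val[OF CAdv l(1) sx tr(4)])
      show "q i (x i) = measure_pmf.expectation ?p (q i)"
        "u i (x i) = - mcost (M i) (act i (x i)) + measure_pmf.expectation ?p (u i)"
        using si i by (auto simp: strategy_def)
    qed
    also have "measure_pmf.expectation ?p
     (\<lambda>s'. greedy_val F (\<lambda>j. q j ((x(i := s')) j)) (\<lambda>j. u j ((x(i := s')) j)) l {}) =
       measure_pmf.expectation ?p (\<lambda>s'. util_fuel k n F M (plan_policy F M go act l)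
          (h @ [(Adv i (act i (x i)), x(i := s'))]) (x(i := s')))"
      by (rule pmf_expectation_cong) (rule IH[symmetric])
    finally show ?thesis
      using i \<open>i < n\<close> a by (simp add: plan_policy_def CAdv legal_adv_def)
  qed
qed

section \<open>Assembling the gap bound\<close>

lemma mdp_values_bounded:
  assumes "cics_instance n F M"
  shows "\<exists>C\<ge>0. \<forall>i<n. \<forall>t\<in>mterm (M i). mval (M i) t \<le> C"
proof -
  have M: "mterm (M i) \<subseteq> mstates (M i)" "finite (mstates (M i))" "\<And>t. t \<in> mterm (M i) \<Longrightarrow> 0 \<le> mval (M i) t"
    if "i < n" for i using assms that by (auto simp: cics_instance_def wf_mdp_def)
  have fin: "finite (mterm (M i))" if "i < n" for i using finite_subset M(1,2)[OF that] .
  have nn: "0 \<le> (\<Sum>t\<in>mterm (M i). mval (M i) t)" if "i < n" for i using M(3)[OF that] by (intro sum_nonneg)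
  have "mval (M i) t \<le> (\<Sum>i<n. \<Sum>t\<in>mterm (M i). mval (M i) t)" if "i < n" "t \<in> mterm (M i)" for i t
  proof -
    have "mval (M i) t \<le> (\<Sum>t\<in>mterm (M i). mval (M i) t)"
      using that M(3) fin by (intro member_le_sum) auto
    also have "\<dots> \<le> (\<Sum>i<n. \<Sum>t\<in>mterm (M i). mval (M i) t)"
      using that nn by (intro member_le_sum[of i _ "\<lambda>i. \<Sum>t\<in>mterm (M i). mval (M i) t"]) auto
    finally show ?thesis .
  qed
  moreover have "0 \<le> (\<Sum>i<n. \<Sum>t\<in>mterm (M i). mval (M i) t)" by (rule sum_nonneg) (simp add: nn)
  ultimately show ?thesis by blast
qed

text \<open>Leaves only the combinatorial inequality \<open>round\<close>, for every
  \<open>C\<close> because the bound on terminal values depends on the MDPs. The scaling by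
  \<open>r\<close> is admissible since the optimum of a single MDP is nonnegative at every price, so
  scaled pairs stay below it.\<close>

lemma commitment_gap_le:
  fixes M :: "nat \<Rightarrow> ('s, 'a) mdp"
  assumes inst: "cics_instance n F M" and "0 \<le> \<alpha>"
    and round: "\<And>q u C. hull_ineqs n F q \<Longrightarrow> (\<And>i. i < n \<Longrightarrow> u i \<le> C * q i) \<Longrightarrow> 0 \<le> C \<Longrightarrow>
      \<exists>l r. distinct l \<and> set l \<subseteq> {..<n} \<and> (\<forall>i<n. 0 \<le> r i \<and> r i \<le> 1) \<and>
        (\<Sum>i<n. u i) \<le> \<alpha> * greedy_val F (\<lambda>i. r i * q i) (\<lambda>i. r i * u i) l {}"
  shows "0 \<le> ComOPT n F M" "OPT n F M \<le> \<alpha> * ComOPT n F M" "ComGap n F M \<le> \<alpha>"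
proof -
  obtain C where "0 \<le> C" and C: "\<And>i t. i < n \<Longrightarrow> t \<in> mterm (M i) \<Longrightarrow> mval (M i) t \<le> C"
    using mdp_values_bounded[OF inst] by blast
  have F: "F \<subseteq> Pow {..<n}" "{} \<in> F" using inst by (auto simp: cics_instance_def downward_closed_def)
  have wf: "wf_mdp (M i)" if "i < n" for i using inst that by (auto simp: cics_instance_def)
  have root: "mroot (M i) \<in> mstates (M i)" if "i < n" for i using wf[OF that] by (auto simp: wf_mdp_def)
  define H where "H = horizon n M"
  have "0 < H" by (simp add: H_def horizon_def)
  have dec: "\<exists>U Q. Util n F M P = (\<Sum>i<n. U i) \<and> hull_ineqs n F Q \<and> (\<forall>i<n. U i \<le> C * Q i) \<and>
     (\<forall>i<n. \<forall>lam e V. 0 \<le> e \<and> priced_super (M i) lam e V \<longrightarrow>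
         U i - lam * Q i \<le> V (mroot (M i)) + real H * e)" for P
    using policy_split[OF inst \<open>0 \<le> C\<close> C, of "\<lambda>i. mroot (M i)" H P "[]"] root
    unfolding split_val_def Util_def H_def by simp
  \<comment> \<open>Boundedness makes \<open>ComOPT\<close> a genuine least upper bound.\<close>
  have ub: "Util n F M P \<le> real n * C" for P
  proof -
    obtain U Q where U: "Util n F M P = (\<Sum>i<n. U i)" and Q: "hull_ineqs n F Q"
      and UC: "\<And>i. i < n \<Longrightarrow> U i \<le> C * Q i" using dec[of P] by blast
    have "U i \<le> C" if "i < n" for i
      using UC[OF that] hull_ineqs_le_1[OF Q F(1) that] \<open>0 \<le> C\<close> mult_left_le[of "Q i" C] by linarith
    then show ?thesis unfolding U using sum_bounded_above[of "{..<n}" U C] by simp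
  qed
  define CP where "CP = {P. \<exists>\<pi>. commitment n M \<pi> \<and> committing \<pi> P}"
  have Com: "Util n F M P \<le> ComOPT n F M" if "P \<in> CP" for P
    unfolding ComOPT_def CP_def[symmetric] using that ub by (intro cSUP_upper bdd_aboveI2)
  have plan: "plan_policy F M go act l \<in> CP"
    if "\<And>i. i < n \<Longrightarrow> strategy (M i) (go i) (act i) (q i) (u i)" for go act q u l
  proof -
    have "commitment n M (\<lambda>i s. return_pmf (act i s))"
      using that by (auto simp: commitment_def strategy_def)
    then show ?thesis using committing_plan_policy unfolding CP_def by blast
  qed
  have heights: "(\<Sum>i<n. mdp_height (M i) (mroot (M i))) < horizon n M"
  proof -
    have "(\<Sum>i<n. mdp_height (M i) (mroot (M i))) \<le> (\<Sum>i<n. card (mstates (M i)))"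
      by (intro sum_mono mdp_height_finite(2) wf) auto
    then show ?thesis by (simp add: horizon_def)
  qed
  have pure: "greedy_val F (\<lambda>i. q i (mroot (M i))) (\<lambda>i. u i (mroot (M i))) l {} \<le> ComOPT n F M"
    if "\<And>i. i < n \<Longrightarrow> strategy (M i) (go i) (act i) (q i) (u i)" "distinct l" "set l \<subseteq> {..<n}"
    for go act q u l
  proof -
    have "Util n F M (plan_policy F M go act l)
       = greedy_val F (\<lambda>i. q i (mroot (M i))) (\<lambda>i. u i (mroot (M i))) l {}"
      unfolding Util_def by (rule util_fuel_plan_policy[OF inst that(2,3,1) root heights])
    then show ?thesis using Com[OF plan[OF that(1)], of l] by simp
  qed
  have le: "Util n F M P \<le> \<alpha> * ComOPT n F M" for P
  proof -
    obtain U Q where U: "Util n F M P = (\<Sum>i<n. U i)" and Q: "hull_ineqs n F Q"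
      and UC: "\<And>i. i < n \<Longrightarrow> U i \<le> C * Q i"
      and UV: "\<And>i lam e V. i < n \<Longrightarrow> 0 \<le> e \<Longrightarrow> priced_super (M i) lam e V \<Longrightarrow>
         U i - lam * Q i \<le> V (mroot (M i)) + real H * e" using dec[of P] by blast
    obtain l r where l: "distinct l" "set l \<subseteq> {..<n}" and r: "\<And>i. i < n \<Longrightarrow> 0 \<le> r i \<and> r i \<le> 1"
      and g: "(\<Sum>i<n. U i) \<le> \<alpha> * greedy_val F (\<lambda>i. r i * Q i) (\<lambda>i. r i * U i) l {}"
      using round[OF Q UC \<open>0 \<le> C\<close>] by blast
    have "greedy_val F (\<lambda>i. r i * Q i) (\<lambda>i. r i * U i) l {} \<le> ComOPT n F M"
    proof (rule field_le_epsilon)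
      fix d :: real assume "0 < d"
      \<comment> \<open>The \<open>n\<close> exchanges lose \<open>e\<close> each, hence at most
        \<open>d\<close> in total; the \<open>+ 1\<close> covers \<open>n = 0\<close>.\<close>
      define e where "e = d / (real n + 1)"
      have "0 < e" using \<open>0 < d\<close> by (simp add: e_def)
      \<comment> \<open>Each pair is stored with a strategy realising it, so that strategies can be
        read off after rounding.\<close>
      define X where "X = (\<lambda>i. {((go, act, q, u), (a, b)) |go act q u a b.
          strategy (M i) go act q u \<and> a = q (mroot (M i)) \<and> b = u (mroot (M i))})"
      have "\<exists>\<sigma>. (\<forall>i<n. \<sigma> i \<in> X i) \<and>
         greedy_val F (\<lambda>i. r i * Q i) (\<lambda>i. r i * U i) l {}
           \<le> greedy_val F (\<lambda>i. fst (snd (\<sigma> i))) (\<lambda>i. snd (snd (\<sigma> i))) l {} + real n * e"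
      proof (rule greedy_val_round[OF l(1) _ l(2)])
        show "0 \<le> r i * Q i \<and> r i * Q i \<le> 1" if "i < n" for i
          using r[OF that] hull_ineqs_nonneg[OF Q F(1) that] hull_ineqs_le_1[OF Q F(1) that] mult_le_one by auto
        show "0 \<le> fst (snd p) \<and> fst (snd p) \<le> 1" if "i < n" "p \<in> X i" for i p
          using that root by (auto simp: X_def strategy_def)
        show "\<exists>p\<in>X i. r i * U i - lam * (r i * Q i) \<le> snd (snd p) - lam * fst (snd p) + e"
          if "i < n" for i lam
        proof -
          \<comment> \<open>\<open>policy_split\<close> pays the slack once for each of the
            \<open>H\<close> units of fuel, which adds up to \<open>e\<close>.\<close>
          have "0 < e / real H" using \<open>0 < e\<close> \<open>0 < H\<close> by simp
          from priced_strategy_exists[OF wf[OF that] this, of lam]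
          obtain go act q u where st: "strategy (M i) go act q u"
            and ps: "priced_super (M i) lam (e / real H) (\<lambda>s. u s - lam * q s)" by blast
          let ?v = "u (mroot (M i)) - lam * q (mroot (M i))"
          have "0 \<le> ?v" using ps root[OF that] by (auto simp: priced_super_def)
          have "r i * U i - lam * (r i * Q i) = r i * (U i - lam * Q i)" by (simp add: algebra_simps)
          also have "\<dots> \<le> r i * (?v + e)"
            using UV[OF that _ ps] r[OF that] \<open>0 < e / real H\<close> \<open>0 < H\<close> by (intro mult_left_mono) auto
          also have "\<dots> \<le> ?v + e"
            using r[OF that] \<open>0 \<le> ?v\<close> \<open>0 < e\<close> by (intro mult_left_le_one_le) auto
          finally show ?thesis
            using st by (intro bexI[of _ "((go, act, q, u), (q (mroot (M i)), u (mroot (M i))))"]) (auto simp: X_def)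
        qed
      qed (use \<open>0 < e\<close> in auto)
      then obtain \<sigma> where \<sigma>: "\<And>i. i < n \<Longrightarrow> \<sigma> i \<in> X i" and
        le: "greedy_val F (\<lambda>i. r i * Q i) (\<lambda>i. r i * U i) l {}
           \<le> greedy_val F (\<lambda>i. fst (snd (\<sigma> i))) (\<lambda>i. snd (snd (\<sigma> i))) l {} + real n * e" by blast
      define go where "go = (\<lambda>i. fst (fst (\<sigma> i)))"
      define act where "act = (\<lambda>i. fst (snd (fst (\<sigma> i))))"
      define q where "q = (\<lambda>i. fst (snd (snd (fst (\<sigma> i)))))"
      define u where "u = (\<lambda>i. snd (snd (snd (fst (\<sigma> i)))))"
      have st: "strategy (M i) (go i) (act i) (q i) (u i)"
        and qu: "fst (snd (\<sigma> i)) = q i (mroot (M i))" "snd (snd (\<sigma> i)) = u i (mroot (M i))" if "i < n" for i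
        using \<sigma>[OF that] unfolding X_def go_def act_def q_def u_def by auto
      have "greedy_val F (\<lambda>i. fst (snd (\<sigma> i))) (\<lambda>i. snd (snd (\<sigma> i))) l {} =
          greedy_val F (\<lambda>i. q i (mroot (M i))) (\<lambda>i. u i (mroot (M i))) l {}"
        using l qu by (intro greedy_val_cong) auto
      also have "\<dots> \<le> ComOPT n F M" by (rule pure[OF st l])
      finally have "greedy_val F (\<lambda>i. fst (snd (\<sigma> i))) (\<lambda>i. snd (snd (\<sigma> i))) l {} \<le> ComOPT n F M" .
      moreover have "real n * e \<le> d" using \<open>0 < d\<close> by (simp add: e_def field_simps)
      ultimately show "greedy_val F (\<lambda>i. r i * Q i) (\<lambda>i. r i * U i) l {} \<le> ComOPT n F M + d"
        using le by linarith
    qed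
    then show ?thesis using g U \<open>0 \<le> \<alpha>\<close> mult_left_mono by fastforce
  qed
  \<comment> \<open>The plan over the empty list halts at once with value 0; strategies are chosen
    to supply its commitment.\<close>
  show nonneg: "0 \<le> ComOPT n F M"
  proof -
    have "\<exists>st. \<forall>i. i < n \<longrightarrow> strategy (M i) (fst (st i)) (fst (snd (st i))) (fst (snd (snd (st i)))) (snd (snd (snd (st i))))"
      using priced_strategy_exists[OF wf, of _ 1 0] by (intro choice) fastforce
    then obtain st where "\<And>i. i < n \<Longrightarrow>
        strategy (M i) (fst (st i)) (fst (snd (st i))) (fst (snd (snd (st i)))) (snd (snd (snd (st i))))" by blast
    from pure[OF this, of "[]"] show ?thesis by simp
  qed
  show opt: "OPT n F M \<le> \<alpha> * ComOPT n F M"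
    unfolding OPT_def using le by (intro cSUP_least) auto
  show "ComGap n F M \<le> \<alpha>"
    using nonneg opt \<open>0 \<le> \<alpha>\<close> unfolding ComGap_def
    by (cases "ComOPT n F M = 0") (auto simp: divide_le_eq)
qed

text \<open>Each bound is also given as a product: if \<open>ComOPT\<close> is 0, then
  \<open>ComGap\<close> is 0 by the convention for division, whereas the product form still yields
  \<open>OPT\<close> at most 0.\<close>

theorem theorem5:
  fixes n :: nat and F :: "nat set set" and M :: "nat \<Rightarrow> ('s, 'a) mdp"
  assumes "cics_instance n F M"
  shows "(matroid_indep n F \<longrightarrow>
            ComGap n F M \<le> exp 1 / (exp 1 - 1) \<and> OPT n F M \<le> exp 1 / (exp 1 - 1) * ComOPT n F M)
       \<and> (\<forall>k :: nat. k_system k n F \<longrightarrow>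
            ComGap n F M \<le> real k + 1 \<and> OPT n F M \<le> (real k + 1) * ComOPT n F M)
       \<and> (knapsack n F \<longrightarrow>
            ComGap n F M \<le> 3.135 \<and> OPT n F M \<le> 3.135 * ComOPT n F M)"
proof (intro conjI allI impI)
  have F: "F \<subseteq> Pow {..<n}" "{} \<in> F" "downward_closed F"
    using assms by (auto simp: cics_instance_def downward_closed_def)
  {
    assume m: "matroid_indep n F"
    note gap = commitment_gap_le[OF assms _ greedy_by_density[OF F(1) _ _ _ matroid_prefix[OF m]]]
    show "ComGap n F M \<le> exp 1 / (exp 1 - 1)" by (rule gap(3)) auto
    show "OPT n F M \<le> exp 1 / (exp 1 - 1) * ComOPT n F M" by (rule gap(2)) auto
  next
    fix k assume k: "k_system k n F"
    note gap = commitment_gap_le[OF assms _ greedy_by_density[OF F(1) _ _ _ k_system_prefix[OF k F(1,3,2)]]]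
    show "ComGap n F M \<le> real k + 1" by (rule gap(3)) auto
    show "OPT n F M \<le> (real k + 1) * ComOPT n F M" by (rule gap(2)) auto
  next
    assume s: "knapsack n F"
    have "\<exists>l r. distinct l \<and> set l \<subseteq> {..<n} \<and> (\<forall>i<n. 0 \<le> r i \<and> r i \<le> 1) \<and>
        (\<Sum>i<n. u i) \<le> 3 * greedy_val F (\<lambda>i. r i * q i) (\<lambda>i. r i * u i) l {}"
      if "hull_ineqs n F q" for q u
      using knapsack_greedy[OF s that, of u] by (metis order_refl)
    note gap = commitment_gap_le[OF assms _ this]
    \<comment> \<open>Nonnegativity of \<open>ComOPT\<close> is what allows 3 to be replaced by
      3.135 in the product form.\<close>
    have gap3: "0 \<le> ComOPT n F M" "OPT n F M \<le> 3 * ComOPT n F M" "ComGap n F M \<le> 3"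
      by (rule gap; simp)+
    show "ComGap n F M \<le> 3.135" using gap3(3) by simp
    show "OPT n F M \<le> 3.135 * ComOPT n F M"
      using gap3(1,2) by simp
  }
qed

end
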